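(* Every generalized $\tilde D$-metric is a W-GDW-metric (weakly generalized Douglas-Weyl Finsler metric).
   Context: Let $M$ be an $n$-dimensional smooth manifold. A Finsler metric on $M$ is a non-negative function $F$ on $TM$ that is $C^\infty$ on $TM_0=TM\setminus\{0\}$, positively homogeneous of degree one in $y$, and such that $g_{ij}=\frac12\frac{\partial^2F^2}{\partial y^i\partial y^j}$ is positive definite at every $y\neq 0$. Its spray coefficients are $G^i(x,y)=\frac14 g^{il}\left\{\frac{\partial^2F^2}{\partial x^k\partial y^l}y^k-\frac{\partial F^2}{\partial x^l}\right\}$. Notation: "$._k$" denotes $\partial/\partial y^k$; "$|_m$" denotes the horizontal covariant derivative with respect to the Berwald connection of $F$, e.g. $T^i{}_{j|m}=\frac{\partial T^i{}_j}{\partial x^m}-G^r{}_{.m}T^i{}_{j.r}+T^r{}_jG^i{}_{.r.m}-T^i{}_rG^r{}_{.j.m}$, and similarly for other tensors on $TM_0$. A subscript $0$ denotes contraction with $y$: $T_{|0}=T_{|m}y^m$. The Douglas tensor is $D_j{}^i{}_{kl}=\frac{\partial^3}{\partial y^j\partial y^k\partial y^l}\left(G^i-\frac1{n+1}\frac{\partial G^m}{\partial y^m}y^i\right)$. Put $\tilde D_j{}^i{}_{kl}=D_j{}^i{}_{kl|0}$. $F$ is a generalized $\tilde D$-metric if $\tilde D_j{}^i{}_{kl|0}+\mu_r\tilde D_j{}^r{}_{kl}y^i=0$ for the coefficients $\mu_r$ of some tensor. $F$ is a W-GDW-metric if there are a scalar function $\lambda=\lambda(x,y)$ on $TM$ and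 coefficients $U_{jkl}$ of some tensor field such that $\tilde D_j{}^i{}_{kl|0}+\lambda F\tilde D_j{}^i{}_{kl}=U_{jkl}y^i$. *)

theory Defs
  imports "HOL-Analysis.Analysis"
begin

section \<open>Smooth maps between Euclidean spaces\<close>

text \<open>Intended for open sets \<open>S\<close>.\<close>

primrec Ck_on :: "nat \<Rightarrow> 'a::euclidean_space set \<Rightarrow> ('a \<Rightarrow> 'b::euclidean_space) \<Rightarrow> bool" where
  "Ck_on 0 S f \<longleftrightarrow> continuous_on S f"
| "Ck_on (Suc k) S f \<longleftrightarrow>
     (\<forall>x\<in>S. f differentiable (at x)) \<and> (\<forall>v. Ck_on k S (\<lambda>x. frechet_derivative f (at x) v))"

definition smooth_on :: "'a::euclidean_space set \<Rightarrow> ('a \<Rightarrow> 'b::euclidean_space) \<Rightarrow> bool" where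
  "smooth_on S f \<longleftrightarrow> (\<forall>k. Ck_on k S f)"


section \<open>Smooth manifolds and their tangent bundles\<close>

type_synonym ('a, 'n) chart = "'a set \<times> ('a \<Rightarrow> real ^ 'n)"

abbreviation chart_dom :: "('a, 'n::finite) chart \<Rightarrow> 'a set" where
  "chart_dom c \<equiv> fst c"

abbreviation chart_im :: "('a, 'n::finite) chart \<Rightarrow> (real ^ 'n) set" where
  "chart_im c \<equiv> snd c ` fst c"

definition chart_inv :: "('a, 'n::finite) chart \<Rightarrow> real ^ 'n \<Rightarrow> 'a" where
  "chart_inv c = inv_into (fst c) (snd c)"

definition transition :: "('a, 'n::finite) chart \<Rightarrow> ('a, 'n) chart \<Rightarrow> real ^ 'n \<Rightarrow> real ^ 'n" where
  "transition c d = (\<lambda>x. snd d (chart_inv c x))"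

definition overlap :: "('a, 'n::finite) chart \<Rightarrow> ('a, 'n) chart \<Rightarrow> (real ^ 'n) set" where
  "overlap c d = snd c ` (chart_dom c \<inter> chart_dom d)"

definition jac :: "('a, 'n::finite) chart \<Rightarrow> ('a, 'n) chart \<Rightarrow> real ^ 'n \<Rightarrow> real ^ 'n \<Rightarrow> real ^ 'n" where
  "jac c d x = frechet_derivative (transition c d) (at x)"

text \<open>The dimension is \<open>n = CARD('n)\<close>. The atlas \<open>A\<close> need not be maximal; ``local
  coordinates'' always means a chart of \<open>A\<close>.\<close>

definition smooth_manifold :: "'a topology \<Rightarrow> ('a, 'n::finite) chart set \<Rightarrow> bool" where
  "smooth_manifold M A \<longleftrightarrow>
     Hausdorff_space M \<and> second_countable M \<and>
     (\<Union>c\<in>A. chart_dom c) = topspace M \<and>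
     (\<forall>c\<in>A. openin M (chart_dom c) \<and> open (chart_im c) \<and>
        homeomorphic_map (subtopology M (chart_dom c)) (top_of_set (chart_im c)) (snd c)) \<and>
     (\<forall>c\<in>A. \<forall>d\<in>A. smooth_on (overlap c d) (transition c d))"

text \<open>A tangent vector at \<open>p\<close> is the family of its component vectors in all charts around \<open>p\<close>,
  related by the Jacobians of the transition maps; the value \<open>0\<close> is a dummy for all other
  arguments.\<close>

type_synonym ('a, 'n) tvec = "('a, 'n) chart \<Rightarrow> real ^ 'n"

definition tangent_space :: "('a, 'n::finite) chart set \<Rightarrow> 'a \<Rightarrow> ('a, 'n) tvec set" where
  "tangent_space A p =
     {v. (\<forall>c\<in>A. \<forall>d\<in>A. p \<in> chart_dom c \<inter> chart_dom d \<longrightarrow> v d = jac c d (snd c p) (v c)) \<and>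
         (\<forall>c. \<not> (c \<in> A \<and> p \<in> chart_dom c) \<longrightarrow> v c = 0)}"

definition tangent_bundle ::
    "'a topology \<Rightarrow> ('a, 'n::finite) chart set \<Rightarrow> ('a \<times> ('a, 'n) tvec) set" where
  "tangent_bundle M A = (SIGMA p : topspace M. tangent_space A p)"

text \<open>The element of the tangent bundle with coordinates \<open>(x, y)\<close> in the chart \<open>c\<close>.\<close>

definition tb_point ::
    "('a, 'n::finite) chart set \<Rightarrow> ('a, 'n) chart \<Rightarrow> real ^ 'n \<Rightarrow> real ^ 'n \<Rightarrow> 'a \<times> ('a, 'n) tvec" where
  "tb_point A c x y =
     (chart_inv c x, \<lambda>d. if d \<in> A \<and> chart_inv c x \<in> chart_dom d then jac c d x y else 0)"

type_synonym 'n local_fun = "real ^ 'n \<Rightarrow> real ^ 'n \<Rightarrow> real"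

definition local_expr ::
    "('a, 'n::finite) chart set \<Rightarrow> ('a \<times> ('a, 'n) tvec \<Rightarrow> real) \<Rightarrow> ('a, 'n) chart \<Rightarrow> 'n local_fun" where
  "local_expr A f c = (\<lambda>x y. f (tb_point A c x y))"

text \<open>Coordinate domain of the slit tangent bundle (zero section removed) in the chart \<open>c\<close>.\<close>

definition slit_dom :: "('a, 'n::finite) chart \<Rightarrow> ((real ^ 'n) \<times> (real ^ 'n)) set" where
  "slit_dom c = chart_im c \<times> (- {0})"

definition smooth_on_slit ::
    "('a, 'n::finite) chart set \<Rightarrow> ('a \<times> ('a, 'n) tvec \<Rightarrow> real) \<Rightarrow> bool" where
  "smooth_on_slit A f \<longleftrightarrow> (\<forall>c\<in>A. smooth_on (slit_dom c) (\<lambda>(x, y). local_expr A f c x y))"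


section \<open>Tensor fields on the slit tangent bundle\<close>

text \<open>Tensors are given by their coefficients in each chart, transforming by the Jacobian of the
  change of coordinates on \<open>M\<close>. \<open>jac_coeff c d s r x\<close> is the partial derivative of the
  \<open>s\<close>-th \<open>d\<close>-coordinate with respect to the \<open>r\<close>-th \<open>c\<close>-coordinate.\<close>

definition jac_coeff ::
    "('a, 'n::finite) chart \<Rightarrow> ('a, 'n) chart \<Rightarrow> 'n \<Rightarrow> 'n \<Rightarrow> real ^ 'n \<Rightarrow> real" where
  "jac_coeff c d s r x = jac c d x (axis r 1) $ s"

definition tensor01_coeffs ::
    "('a, 'n::finite) chart set \<Rightarrow> (('a, 'n) chart \<Rightarrow> 'n \<Rightarrow> 'n local_fun) \<Rightarrow> bool" where
  "tensor01_coeffs A \<mu> \<longleftrightarrow>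
     (\<forall>c\<in>A. \<forall>r. smooth_on (slit_dom c) (\<lambda>(x, y). \<mu> c r x y)) \<and>
     (\<forall>c\<in>A. \<forall>d\<in>A. \<forall>x\<in>overlap c d. \<forall>y. y \<noteq> 0 \<longrightarrow> (\<forall>r.
        \<mu> c r x y = (\<Sum>s\<in>UNIV. jac_coeff c d s r x * \<mu> d s (transition c d x) (jac c d x y))))"

definition tensor03_coeffs ::
    "('a, 'n::finite) chart set \<Rightarrow> (('a, 'n) chart \<Rightarrow> 'n \<Rightarrow> 'n \<Rightarrow> 'n \<Rightarrow> 'n local_fun) \<Rightarrow> bool" where
  "tensor03_coeffs A U \<longleftrightarrow>
     (\<forall>c\<in>A. \<forall>j k l. smooth_on (slit_dom c) (\<lambda>(x, y). U c j k l x y)) \<and>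
     (\<forall>c\<in>A. \<forall>d\<in>A. \<forall>x\<in>overlap c d. \<forall>y. y \<noteq> 0 \<longrightarrow> (\<forall>j k l.
        U c j k l x y =
          (\<Sum>p\<in>UNIV. \<Sum>q\<in>UNIV. \<Sum>r\<in>UNIV.
             jac_coeff c d p j x * jac_coeff c d q k x * jac_coeff c d r l x *
             U d p q r (transition c d x) (jac c d x y))))"


section \<open>Finsler metrics\<close>

definition dx :: "'n::finite \<Rightarrow> 'n local_fun \<Rightarrow> 'n local_fun" where
  "dx k f = (\<lambda>x y. deriv (\<lambda>t. f (x + t *\<^sub>R axis k 1) y) 0)"

definition dy :: "'n::finite \<Rightarrow> 'n local_fun \<Rightarrow> 'n local_fun" where
  "dy k f = (\<lambda>x y. deriv (\<lambda>t. f x (y + t *\<^sub>R axis k 1)) 0)"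

text \<open>Below, \<open>f\<close> is the expression of \<open>F\<close> in some local coordinates.\<close>

definition fund_tensor :: "'n::finite local_fun \<Rightarrow> real ^ 'n \<Rightarrow> real ^ 'n \<Rightarrow> real ^ 'n ^ 'n" where
  "fund_tensor f x y = (\<chi> i j. 1/2 * dy i (dy j (\<lambda>x y. (f x y)\<^sup>2)) x y)"

definition finsler_metric ::
    "'a topology \<Rightarrow> ('a, 'n::finite) chart set \<Rightarrow> ('a \<times> ('a, 'n) tvec \<Rightarrow> real) \<Rightarrow> bool" where
  "finsler_metric M A F \<longleftrightarrow>
     (\<forall>w\<in>tangent_bundle M A. F w \<ge> 0) \<and>
     smooth_on_slit A F \<and>
     (\<forall>(p, v)\<in>tangent_bundle M A. \<forall>a>0. F (p, \<lambda>c. a *\<^sub>R v c) = a * F (p, v)) \<and>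
     (\<forall>c\<in>A. \<forall>(x, y)\<in>slit_dom c. \<forall>u. u \<noteq> 0 \<longrightarrow>
        u \<bullet> (fund_tensor (local_expr A F c) x y *v u) > 0)"

definition spray :: "'n::finite local_fun \<Rightarrow> 'n \<Rightarrow> 'n local_fun" where
  "spray f i = (\<lambda>x y. 1/4 * (\<Sum>l\<in>UNIV. matrix_inv (fund_tensor f x y) $ i $ l *
     ((\<Sum>k\<in>UNIV. dx k (dy l (\<lambda>x y. (f x y)\<^sup>2)) x y * y $ k) - dx l (\<lambda>x y. (f x y)\<^sup>2) x y)))"


section \<open>Berwald covariant derivative and Douglas tensor\<close>

text \<open>A tensor with coefficients \<open>T\<^sub>j\<^sup>i\<^sub>k\<^sub>l\<close> is written \<open>T j i k l\<close>.\<close>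

type_synonym 'n local_tensor13 = "'n \<Rightarrow> 'n \<Rightarrow> 'n \<Rightarrow> 'n \<Rightarrow> 'n local_fun"

definition berwald_hderiv ::
    "'n::finite local_fun \<Rightarrow> 'n local_tensor13 \<Rightarrow> 'n \<Rightarrow> 'n local_tensor13" where
  "berwald_hderiv f T m j i k l = (\<lambda>x y.
     dx m (T j i k l) x y
     - (\<Sum>r\<in>UNIV. dy m (spray f r) x y * dy r (T j i k l) x y)
     + (\<Sum>r\<in>UNIV. T j r k l x y * dy m (dy r (spray f i)) x y)
     - (\<Sum>r\<in>UNIV. T r i k l x y * dy m (dy j (spray f r)) x y)
     - (\<Sum>r\<in>UNIV. T j i r l x y * dy m (dy k (spray f r)) x y)
     - (\<Sum>r\<in>UNIV. T j i k r x y * dy m (dy l (spray f r)) x y))"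

text \<open>The contraction \<open>T\<^sub>j\<^sup>i\<^sub>k\<^sub>l\<^sub>|\<^sub>0\<close> of the covariant derivative with \<open>y\<close>.\<close>

definition hderiv0 :: "'n::finite local_fun \<Rightarrow> 'n local_tensor13 \<Rightarrow> 'n local_tensor13" where
  "hderiv0 f T j i k l = (\<lambda>x y. \<Sum>m\<in>UNIV. berwald_hderiv f T m j i k l x y * y $ m)"

definition douglas :: "'n::finite local_fun \<Rightarrow> 'n local_tensor13" where
  "douglas f j i k l = dy j (dy k (dy l (\<lambda>x y.
     spray f i x y - 1 / (real CARD('n) + 1) * (\<Sum>m\<in>UNIV. dy m (spray f m) x y) * y $ i)))"

definition Dtilde :: "'n::finite local_fun \<Rightarrow> 'n local_tensor13" where
  "Dtilde f = hderiv0 f (douglas f)"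


section \<open>The two classes of metrics\<close>

definition generalized_Dtilde_metric ::
    "('a, 'n::finite) chart set \<Rightarrow> ('a \<times> ('a, 'n) tvec \<Rightarrow> real) \<Rightarrow> bool" where
  "generalized_Dtilde_metric A F \<longleftrightarrow>
     (\<exists>\<mu>. tensor01_coeffs A \<mu> \<and>
        (\<forall>c\<in>A. \<forall>(x, y)\<in>slit_dom c. \<forall>i j k l.
           hderiv0 (local_expr A F c) (Dtilde (local_expr A F c)) j i k l x y
           + (\<Sum>r\<in>UNIV. \<mu> c r x y * Dtilde (local_expr A F c) j r k l x y) * y $ i = 0))"

definition W_GDW_metric ::
    "('a, 'n::finite) chart set \<Rightarrow> ('a \<times> ('a, 'n) tvec \<Rightarrow> real) \<Rightarrow> bool" where
  "W_GDW_metric A F \<longleftrightarrow>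
     (\<exists>lam U. smooth_on_slit A lam \<and> tensor03_coeffs A U \<and>
        (\<forall>c\<in>A. \<forall>(x, y)\<in>slit_dom c. \<forall>i j k l.
           hderiv0 (local_expr A F c) (Dtilde (local_expr A F c)) j i k l x y
           + local_expr A lam c x y * local_expr A F c x y * Dtilde (local_expr A F c) j i k l x y
           = U c j k l x y * y $ i))"

end

theory Submission
  imports Defs
begin

text \<open>
  Take \<open>\<lambda> = 0\<close> and \<open>U\<^sub>j\<^sub>k\<^sub>l = - \<mu>\<^sub>r D\<^sub>j\<^sup>r\<^sub>k\<^sub>l\<^sub>|\<^sub>0\<close>. What has to be shown is that \<open>U\<close> is a smooth tensor, i.e. that
  \<open>D\<^sub>j\<^sup>i\<^sub>k\<^sub>l\<^sub>|\<^sub>0\<close> is one. Let \<open>J\<close> and \<open>H\<close> be the first and second derivative of a change of coordinates. The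
  spray is determined by the Euler--Lagrange equations of \<open>F\<^sup>2\<close>, hence \<open>G' = J G - H(y, y)/2\<close>. The vertical
  derivatives of this identity give the transformation rules of the nonlinear and of the Berwald
  connection. Taking the trace of the first one shows that \<open>G - (1/(n+1)) (\<partial>G\<^sup>m/\<partial>y\<^sup>m) y\<close> changes by \<open>J\<close>
  up to a quadratic form in \<open>y\<close>, which three vertical derivatives annihilate.
\<close>

section \<open>Smooth functions\<close>

text \<open>Index calculus is replaced by multilinear maps: \<open>tens\<close> turns a coefficient
  family into a vector-valued trilinear map, and a tensor law becomes commutation with
  \<open>J\<close>. Coordinate partials appear only at the ends, where both sides are compared on
  axis vectors. The obstacle is the inhomogeneous term \<open>H\<close>. Vertical derivatives keep
  the base point fixed, so \<open>J x\<close> acts as a constant linear map and all error terms are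
  polynomial in \<open>y\<close>. The contracted derivative does move the base point, but only in
  direction \<open>y\<close>. Differentiating \<open>J\<close> in a tensor law then produces terms
  \<open>H x y\<close>, and these are exactly the terms by which the Berwald connection fails to be
  a tensor. They cancel for every tensor of this type, so the work splits into a step special to the
  Douglas tensor and a general covariance step. No third derivative of a transition map occurs: the
  correction to the spray, which contains the second one, is only differentiated vertically.\<close>

lemma Ck_on_cong:
  assumes "open S" "\<And>x. x \<in> S \<Longrightarrow> f x = g x" "Ck_on k S f"
  shows "Ck_on k S g"
  using assms(2,3)
proof (induction k arbitrary: f g)
  case 0
  then show ?case using continuous_on_cong[of S S f g] by simp
next
  case (Suc k)
  have d: "f differentiable (at x)" if "x \<in> S" for x
    using Suc.prems that by simp
  have "g differentiable (at x)" if "x \<in> S" for x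
    using d[OF that] has_derivative_transform_within_open[OF _ assms(1) that] Suc.prems(1)
    unfolding differentiable_def by blast
  moreover have "Ck_on k S (\<lambda>x. frechet_derivative g (at x) v)" for v
  proof (rule Suc.IH)
    show "frechet_derivative f (at x) v = frechet_derivative g (at x) v" if "x \<in> S" for x
      using frechet_derivative_transform_within_open[OF d[OF that] assms(1) that] Suc.prems(1)
      by simp
    show "Ck_on k S (\<lambda>x. frechet_derivative f (at x) v)"
      using Suc.prems by simp
  qed
  ultimately show ?case by simp
qed

text \<open>Lets the next derivative be read off from the standard differentiation rules; uniqueness
  of the derivative turns it back into \<open>frechet_derivative\<close>.\<close>

lemma Ck_on_SucI:
  assumes "open S" "\<And>x. x \<in> S \<Longrightarrow> (f has_derivative f' x) (at x)"
    "\<And>v. Ck_on k S (\<lambda>x. f' x v)"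
  shows "Ck_on (Suc k) S f"
proof -
  have "frechet_derivative f (at x) = f' x" if "x \<in> S" for x
    using frechet_derivative_at[OF assms(2)[OF that]] by simp
  then have "Ck_on k S (\<lambda>x. frechet_derivative f (at x) v)" for v
    using Ck_on_cong[OF assms(1) _ assms(3)[of v]] by simp
  then show ?thesis
    using assms(2) by (auto simp: differentiable_def)
qed

lemma Ck_on_SucD:
  assumes "Ck_on (Suc k) S f" "x \<in> S"
  shows "(f has_derivative frechet_derivative f (at x)) (at x)"
  using assms frechet_derivative_works by auto

text \<open>Needed for products: the derivative of \<open>f * g\<close> contains the
  undifferentiated factors, which must be available at order \<open>k\<close>.\<close>

lemma Ck_on_Suc_imp: "Ck_on (Suc k) S f \<Longrightarrow> Ck_on k S f"
proof (induction k arbitrary: f)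
  case 0
  then show ?case
    by (auto intro!: continuous_at_imp_continuous_on differentiable_imp_continuous_within)
next
  case (Suc k)
  then show ?case by (metis Ck_on.simps(2))
qed

lemma Ck_on_const: "open S \<Longrightarrow> Ck_on k S (\<lambda>x. c)"
  by (induction k arbitrary: c) auto

lemma Ck_on_compose_linear:
  assumes "open S" "bounded_linear h" "Ck_on k S f"
  shows "Ck_on k S (\<lambda>x. h (f x))"
  using assms(3)
proof (induction k arbitrary: f)
  case 0
  then show ?case
    using bounded_linear.continuous_on[OF assms(2)] by simp
next
  case (Suc k)
  show ?case
    by (rule Ck_on_SucI[OF assms(1) bounded_linear.has_derivative[OF assms(2) Ck_on_SucD[OF Suc.prems]]])
       (use Suc in auto)
qed

lemma Ck_on_add:
  assumes "open S" "Ck_on k S f" "Ck_on k S g"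
  shows "Ck_on k S (\<lambda>x. f x + g x)"
  using assms(2,3)
proof (induction k arbitrary: f g)
  case 0
  then show ?case by (simp add: continuous_on_add)
next
  case (Suc k)
  show ?case
    by (rule Ck_on_SucI[OF assms(1) has_derivative_add[OF Ck_on_SucD[OF Suc.prems(1)] Ck_on_SucD[OF Suc.prems(2)]]])
       (use Suc in auto)
qed

lemma Ck_on_mult:
  fixes f g :: "_ \<Rightarrow> real"
  assumes "open S" "Ck_on k S f" "Ck_on k S g"
  shows "Ck_on k S (\<lambda>x. f x * g x)"
  using assms(2,3)
proof (induction k arbitrary: f g)
  case 0
  then show ?case by (simp add: continuous_on_mult)
next
  case (Suc k)
  show ?case
  proof (rule Ck_on_SucI[OF assms(1) has_derivative_mult[OF Ck_on_SucD[OF Suc.prems(1)] Ck_on_SucD[OF Suc.prems(2)]]])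
    show "Ck_on k S (\<lambda>x. f x * frechet_derivative g (at x) v + frechet_derivative f (at x) v * g x)" for v
      using Suc.prems Ck_on_Suc_imp[OF Suc.prems(1)] Ck_on_Suc_imp[OF Suc.prems(2)]
      by (intro Ck_on_add[OF assms(1)] Suc.IH) auto
  qed
qed

lemma Ck_on_inverse:
  fixes f :: "_ \<Rightarrow> real"
  assumes "open S" "Ck_on k S f" "\<And>x. x \<in> S \<Longrightarrow> f x \<noteq> 0"
  shows "Ck_on k S (\<lambda>x. inverse (f x))"
  using assms(2,3)
proof (induction k arbitrary: f)
  case 0
  then show ?case by (simp add: continuous_on_inverse)
next
  case (Suc k)
  \<comment> \<open>The derivative of the reciprocal contains the reciprocal again, so its
    regularity at order \<open>k\<close> has to come first.\<close>
  have "Ck_on k S (\<lambda>x. inverse (f x))"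
    using Suc Ck_on_Suc_imp by blast
  then show ?case
    by (intro Ck_on_SucI[OF assms(1) Deriv.has_derivative_inverse[OF Suc.prems(2) Ck_on_SucD[OF Suc.prems(1)]]]
        Ck_on_compose_linear[OF assms(1) bounded_linear_minus[OF bounded_linear_ident]] Ck_on_mult[OF assms(1)])
       (use Suc.prems in auto)
qed

section \<open>Closure rules for smooth functions\<close>

lemma smooth_on_cong:
  "open S \<Longrightarrow> (\<And>x. x \<in> S \<Longrightarrow> f x = g x) \<Longrightarrow> smooth_on S f \<Longrightarrow> smooth_on S g"
  unfolding smooth_on_def using Ck_on_cong by blast

lemma smooth_on_const: "open S \<Longrightarrow> smooth_on S (\<lambda>x. c)"
  by (simp add: smooth_on_def Ck_on_const)

lemma smooth_on_compose_linear:
  "open S \<Longrightarrow> bounded_linear h \<Longrightarrow> smooth_on S f \<Longrightarrow> smooth_on S (\<lambda>x. h (f x))"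
  by (simp add: smooth_on_def Ck_on_compose_linear)

lemma smooth_on_add:
  "open S \<Longrightarrow> smooth_on S f \<Longrightarrow> smooth_on S g \<Longrightarrow> smooth_on S (\<lambda>x. f x + g x)"
  by (simp add: smooth_on_def Ck_on_add)

lemma smooth_on_minus: "open S \<Longrightarrow> smooth_on S f \<Longrightarrow> smooth_on S (\<lambda>x. - f x)"
  by (rule smooth_on_compose_linear[OF _ bounded_linear_minus[OF bounded_linear_ident]])

lemma smooth_on_diff:
  "open S \<Longrightarrow> smooth_on S f \<Longrightarrow> smooth_on S g \<Longrightarrow> smooth_on S (\<lambda>x. f x - g x)"
  using smooth_on_add[of S f "\<lambda>x. - g x"] smooth_on_minus[of S g] by simp

lemma smooth_on_mult:
  fixes f g :: "_ \<Rightarrow> real"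
  shows "open S \<Longrightarrow> smooth_on S f \<Longrightarrow> smooth_on S g \<Longrightarrow> smooth_on S (\<lambda>x. f x * g x)"
  by (simp add: smooth_on_def Ck_on_mult)

lemma smooth_on_divide:
  fixes f g :: "_ \<Rightarrow> real"
  assumes "open S" "smooth_on S f" "smooth_on S g" "\<And>x. x \<in> S \<Longrightarrow> g x \<noteq> 0"
  shows "smooth_on S (\<lambda>x. f x / g x)"
  using assms unfolding smooth_on_def divide_inverse
  by (intro allI Ck_on_mult Ck_on_inverse) auto

lemma smooth_on_sum:
  assumes "open S" "\<And>i. i \<in> I \<Longrightarrow> smooth_on S (f i)"
  shows "smooth_on S (\<lambda>x. \<Sum>i\<in>I. f i x)"
  using assms(2) by (induction I rule: infinite_finite_induct)
    (auto intro: smooth_on_const smooth_on_add assms(1))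

lemma smooth_on_prod:
  fixes f :: "_ \<Rightarrow> _ \<Rightarrow> real"
  assumes "open S" "\<And>i. i \<in> I \<Longrightarrow> smooth_on S (f i)"
  shows "smooth_on S (\<lambda>x. \<Prod>i\<in>I. f i x)"
  using assms(2) by (induction I rule: infinite_finite_induct)
    (auto intro: smooth_on_const smooth_on_mult assms(1))

lemma smooth_on_linear:
  assumes "open S" "bounded_linear h"
  shows "smooth_on S h"
  unfolding smooth_on_def
proof
  fix k show "Ck_on k S h"
  proof (cases k)
    case 0
    then show ?thesis using linear_continuous_on[OF assms(2)] by simp
  next
    case (Suc m)
    then show ?thesis
      using Ck_on_SucI[OF assms(1) bounded_linear_imp_has_derivative[OF assms(2)] Ck_on_const[OF assms(1)]]
      by (simp del: Ck_on.simps)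
  qed
qed

lemma smooth_on_vec:
  fixes f :: "'i::finite \<Rightarrow> 'a::euclidean_space \<Rightarrow> real"
  assumes "open S" "\<And>i. smooth_on S (f i)"
  shows "smooth_on S (\<lambda>x. \<chi> i. f i x)"
proof -
  have "smooth_on S (\<lambda>x. \<Sum>i\<in>UNIV. f i x *\<^sub>R axis i (1::real))"
  proof (rule smooth_on_sum[OF assms(1)])
    show "smooth_on S (\<lambda>x. f i x *\<^sub>R axis i (1::real))" for i
      by (rule smooth_on_compose_linear[OF assms(1) bounded_linear_scaleR_left assms(2)])
  qed
  moreover have "(\<Sum>i\<in>UNIV. f i x *\<^sub>R axis i (1::real)) = (\<chi> i. f i x)" for x
    using basis_expansion[of "\<chi> i. f i x"] by (simp add: scalar_mult_eq_scaleR)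
  ultimately show ?thesis by simp
qed

lemma smooth_on_det:
  fixes f :: "'i::finite \<Rightarrow> 'i \<Rightarrow> 'a::euclidean_space \<Rightarrow> real"
  assumes "open S" "\<And>i j. smooth_on S (f i j)"
  shows "smooth_on S (\<lambda>x. det (\<chi> i j. f i j x))"
  unfolding det_def
  by (intro smooth_on_sum smooth_on_mult smooth_on_prod smooth_on_const assms(1)) (simp add: assms(2))

lemma smooth_on_imp_differentiable: "smooth_on S f \<Longrightarrow> x \<in> S \<Longrightarrow> f differentiable (at x)"
  unfolding smooth_on_def by (metis Ck_on.simps(2))

lemma smooth_on_has_derivative:
  "smooth_on S f \<Longrightarrow> x \<in> S \<Longrightarrow> (f has_derivative frechet_derivative f (at x)) (at x)"
  using smooth_on_imp_differentiable frechet_derivative_works by blast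

lemma smooth_on_derivative: "smooth_on S f \<Longrightarrow> smooth_on S (\<lambda>x. frechet_derivative f (at x) v)"
  unfolding smooth_on_def by (metis Ck_on.simps(2))

lemma smooth_on_imp_continuous_on: "smooth_on S f \<Longrightarrow> continuous_on S f"
  unfolding smooth_on_def by (metis Ck_on.simps(1))

lemma smooth_on_linear_derivative:
  "smooth_on S f \<Longrightarrow> x \<in> S \<Longrightarrow> linear (frechet_derivative f (at x))"
  using smooth_on_imp_differentiable linear_frechet_derivative by blast

subsection \<open>Symmetry of second derivatives\<close>

text \<open>The mean value theorem is applied twice: to the increment in direction \<open>v\<close>
  as a function of the \<open>u\<close>-coordinate, then to the resulting first derivative along
  \<open>v\<close>.\<close>

lemma second_difference_mean_value:
  fixes f :: "'a::euclidean_space \<Rightarrow> real"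
  assumes "smooth_on S f" and t: "0 < t"
    and S: "\<And>r s. 0 \<le> r \<Longrightarrow> r \<le> t \<Longrightarrow> 0 \<le> s \<Longrightarrow> s \<le> t \<Longrightarrow> x + r *\<^sub>R u + s *\<^sub>R v \<in> S"
  obtains r s where "0 \<le> r" "r \<le> t" "0 \<le> s" "s \<le> t"
    "f (x + t *\<^sub>R u + t *\<^sub>R v) - f (x + t *\<^sub>R u) - f (x + t *\<^sub>R v) + f x
      = t * (t * frechet_derivative (\<lambda>z. frechet_derivative f (at z) u) (at (x + r *\<^sub>R u + s *\<^sub>R v)) v)"
proof -
  define D where "D = (\<lambda>z. frechet_derivative f (at z))"
  define D2 where "D2 = (\<lambda>z. frechet_derivative (\<lambda>z. D z u) (at z))"
  have D: "(f has_derivative D z) (at z)" if "z \<in> S" for z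
    using smooth_on_has_derivative[OF assms(1) that] by (simp add: D_def)
  have D2: "((\<lambda>z. D z u) has_derivative D2 z) (at z)" if "z \<in> S" for z
    using smooth_on_has_derivative[OF smooth_on_derivative[OF assms(1)] that] by (simp add: D_def D2_def)
  have lin: "linear (D z)" "linear (D2 z)" if "z \<in> S" for z
    using D[OF that] D2[OF that] by (auto intro: has_derivative_linear)
  have "\<exists>r\<in>{0<..<t}. (f (x + t *\<^sub>R u + t *\<^sub>R v) - f (x + t *\<^sub>R u + 0 *\<^sub>R v)) - (f (x + 0 *\<^sub>R u + t *\<^sub>R v) - f (x + 0 *\<^sub>R u + 0 *\<^sub>R v))
     = D (x + r *\<^sub>R u + t *\<^sub>R v) ((t - 0) *\<^sub>R u) - D (x + r *\<^sub>R u + 0 *\<^sub>R v) ((t - 0) *\<^sub>R u)"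
    using S t
    by (intro mvt_simple[where f = "\<lambda>r. f (x + r *\<^sub>R u + t *\<^sub>R v) - f (x + r *\<^sub>R u + 0 *\<^sub>R v)"])
       (auto intro!: derivative_eq_intros has_derivative_compose[OF _ D] simp del: scaleR_zero_left)
  then obtain r where r: "0 < r" "r < t" and 1:
    "f (x + t *\<^sub>R u + t *\<^sub>R v) - f (x + t *\<^sub>R u) - f (x + t *\<^sub>R v) + f x
      = t * (D (x + r *\<^sub>R u + t *\<^sub>R v) u - D (x + r *\<^sub>R u) u)"
    using S[of _ t] S[of _ 0] t linear_scale[OF lin(1)] by (auto simp: algebra_simps) 
  have "\<exists>s\<in>{0<..<t}. D (x + r *\<^sub>R u + t *\<^sub>R v) u - D (x + r *\<^sub>R u + 0 *\<^sub>R v) u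
     = D2 (x + r *\<^sub>R u + s *\<^sub>R v) ((t - 0) *\<^sub>R v)"
    using S t r
    by (intro mvt_simple[where f = "\<lambda>s. D (x + r *\<^sub>R u + s *\<^sub>R v) u"])
       (auto intro!: derivative_eq_intros has_derivative_compose[OF _ D2])
  then obtain s where s: "0 < s" "s < t" and 2:
    "D (x + r *\<^sub>R u + t *\<^sub>R v) u - D (x + r *\<^sub>R u) u = t * D2 (x + r *\<^sub>R u + s *\<^sub>R v) v"
    using S[of r] r linear_scale[OF lin(2)] by auto
  show ?thesis
    using that[of r s] r s 1 2 by (simp add: D_def D2_def)
qed

text \<open>The second difference is symmetric in \<open>u\<close> and \<open>v\<close>, so the two
  mixed derivatives agree exactly at two points of a small parallelogram; continuity carries this to
  \<open>x\<close>.\<close>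

lemma second_derivative_symmetric_real:
  fixes f :: "'a::euclidean_space \<Rightarrow> real"
  assumes f: "smooth_on S f" and S: "open S" "x \<in> S"
  shows "frechet_derivative (\<lambda>z. frechet_derivative f (at z) u) (at x) v
       = frechet_derivative (\<lambda>z. frechet_derivative f (at z) v) (at x) u"
proof -
  define P where "P = (\<lambda>u v z. frechet_derivative (\<lambda>z. frechet_derivative f (at z) u) (at z) v)"
  have cont: "continuous_on S (P u v)" for u v
    unfolding P_def by (intro smooth_on_imp_continuous_on smooth_on_derivative f)
  have "\<bar>P u v x - P v u x\<bar> < e" if e: "e > 0" for e
  proof -
    have lim: "\<forall>\<^sub>F z in nhds x. \<bar>P u v z - P u v x\<bar> < e / 2" for u v
    proof -
      have "isCont (P u v) x"
        using cont[of u v] S by (simp add: continuous_on_eq_continuous_at)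
      then have "(P u v \<longlongrightarrow> P u v x) (nhds x)"
        by (simp add: isCont_def tendsto_at_iff_tendsto_nhds)
      from tendstoD[OF this, of "e / 2"] e show ?thesis
        by (simp add: dist_real_def)
    qed
    have "\<forall>\<^sub>F z in nhds x. z \<in> S"
      using S by (rule eventually_nhds_in_open)
    then have "\<forall>\<^sub>F z in nhds x. z \<in> S \<and> \<bar>P u v z - P u v x\<bar> < e / 2 \<and> \<bar>P v u z - P v u x\<bar> < e / 2"
      using lim[of u v] lim[of v u] by eventually_elim simp
    then obtain d where d: "d > 0"
      "\<And>z. dist z x < d \<Longrightarrow> z \<in> S \<and> \<bar>P u v z - P u v x\<bar> < e / 2 \<and> \<bar>P v u z - P v u x\<bar> < e / 2"
      by (auto simp: eventually_nhds_metric)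
    \<comment> \<open>Small enough to keep the parallelogram inside the ball of radius
      \<open>d\<close>; the summand 1 covers \<open>u = v = 0\<close>.\<close>
    define t where "t = d / (2 * (norm u + norm v + 1))"
    have n: "norm u + norm v + 1 > 0"
      using norm_ge_zero[of u] norm_ge_zero[of v] by linarith
    have t: "t > 0" "t * (norm u + norm v) < d"
    proof -
      show "t > 0" using d n by (simp add: t_def)
      have "t * (norm u + norm v) < t * (2 * (norm u + norm v + 1))"
        using \<open>t > 0\<close> n by (intro mult_strict_left_mono) auto
      also have "\<dots> = d" using n by (simp add: t_def)
      finally show "t * (norm u + norm v) < d" .
    qed
    have near: "dist (x + r *\<^sub>R u + s *\<^sub>R v) x < d" if "0 \<le> r" "r \<le> t" "0 \<le> s" "s \<le> t" for r s
    proof -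
      have "dist (x + r *\<^sub>R u + s *\<^sub>R v) x = norm (r *\<^sub>R u + s *\<^sub>R v)"
        by (simp add: dist_norm algebra_simps)
      also have "\<dots> \<le> r * norm u + s * norm v"
        using norm_triangle_ineq[of "r *\<^sub>R u" "s *\<^sub>R v"] that by simp
      also have "\<dots> \<le> t * norm u + t * norm v"
        using that by (intro add_mono mult_right_mono) auto
      also have "\<dots> < d" using t(2) by (simp add: algebra_simps)
      finally show ?thesis .
    qed
    note inS = d(2)[OF near, THEN conjunct1]
    have near': "dist (x + r *\<^sub>R v + s *\<^sub>R u) x < d" if "0 \<le> r" "r \<le> t" "0 \<le> s" "s \<le> t" for r s
      using near[OF that(3,4,1,2)] by (simp add: algebra_simps)
    note inS' = d(2)[OF near', THEN conjunct1]
    obtain r s where 1: "0 \<le> r" "r \<le> t" "0 \<le> s" "s \<le> t"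
      "f (x + t *\<^sub>R u + t *\<^sub>R v) - f (x + t *\<^sub>R u) - f (x + t *\<^sub>R v) + f x = t * (t * P u v (x + r *\<^sub>R u + s *\<^sub>R v))"
      using second_difference_mean_value[OF f t(1), of x u v, OF inS] unfolding P_def by blast
    obtain r' s' where 2: "0 \<le> r'" "r' \<le> t" "0 \<le> s'" "s' \<le> t"
      "f (x + t *\<^sub>R v + t *\<^sub>R u) - f (x + t *\<^sub>R v) - f (x + t *\<^sub>R u) + f x = t * (t * P v u (x + r' *\<^sub>R v + s' *\<^sub>R u))"
      using second_difference_mean_value[OF f t(1), of x v u, OF inS'] unfolding P_def by blast
    have "x + t *\<^sub>R v + t *\<^sub>R u = x + t *\<^sub>R u + t *\<^sub>R v" by simp
    with 1(5) 2(5) have "t * (t * P u v (x + r *\<^sub>R u + s *\<^sub>R v)) = t * (t * P v u (x + r' *\<^sub>R v + s' *\<^sub>R u))"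
      by (simp only:)
    with t(1) have "P u v (x + r *\<^sub>R u + s *\<^sub>R v) = P v u (x + r' *\<^sub>R v + s' *\<^sub>R u)"
      by simp
    with d(2)[OF near[OF 1(1-4)]] d(2)[OF near'[OF 2(1-4)]] show ?thesis
      by linarith
  qed
  \<comment> \<open>Taking the difference itself as \<open>e\<close> would make it smaller than
    itself unless it vanishes.\<close>
  from this[of "\<bar>P u v x - P v u x\<bar>"] have "P u v x = P v u x" by auto
  then show ?thesis by (simp add: P_def)
qed

lemma frechet_derivative_linear_compose:
  assumes "f differentiable (at x)" "bounded_linear h"
  shows "frechet_derivative (\<lambda>z. h (f z)) (at x) v = h (frechet_derivative f (at x) v)"
  using frechet_derivative_at[OF bounded_linear.has_derivative[OF assms(2) assms(1)[unfolded frechet_derivative_works]]]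
  by metis

lemma second_derivative_symmetric:
  fixes f :: "'a::euclidean_space \<Rightarrow> 'b::euclidean_space"
  assumes f: "smooth_on S f" and S: "open S" "x \<in> S"
  shows "frechet_derivative (\<lambda>z. frechet_derivative f (at z) u) (at x) v
       = frechet_derivative (\<lambda>z. frechet_derivative f (at z) v) (at x) u"
proof (rule euclidean_eqI)
  fix b :: 'b
  assume "b \<in> Basis"
  note bl = bounded_linear_inner_left[of b]
  have *: "frechet_derivative (\<lambda>z. frechet_derivative f (at z) u) (at x) v \<bullet> b
    = frechet_derivative (\<lambda>z. frechet_derivative (\<lambda>z. f z \<bullet> b) (at z) u) (at x) v" for u v
  proof -
    have d: "(\<lambda>z. frechet_derivative f (at z) u \<bullet> b) differentiable (at x)"
      by (rule smooth_on_imp_differentiable[OF smooth_on_compose_linear[OF S(1) bl smooth_on_derivative[OF f]] S(2)])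
    have "frechet_derivative (\<lambda>z. frechet_derivative f (at z) u) (at x) v \<bullet> b
      = frechet_derivative (\<lambda>z. frechet_derivative f (at z) u \<bullet> b) (at x) v"
      using frechet_derivative_linear_compose[OF smooth_on_imp_differentiable[OF smooth_on_derivative[OF f] S(2)] bl]
      by simp
    also have "\<dots> = frechet_derivative (\<lambda>z. frechet_derivative (\<lambda>z. f z \<bullet> b) (at z) u) (at x) v"
      using frechet_derivative_transform_within_open[OF d S]
        frechet_derivative_linear_compose[OF smooth_on_imp_differentiable[OF f] bl] by metis
    finally show ?thesis .
  qed
  show "frechet_derivative (\<lambda>z. frechet_derivative f (at z) u) (at x) v \<bullet> b
      = frechet_derivative (\<lambda>z. frechet_derivative f (at z) v) (at x) u \<bullet> b"
    unfolding * by (rule second_derivative_symmetric_real[OF smooth_on_compose_linear[OF S(1) bl f] S])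
qed

section \<open>Partial derivatives and directional derivatives\<close>

abbreviation fd :: "('a::real_normed_vector \<Rightarrow> 'b::real_normed_vector) \<Rightarrow> 'a \<Rightarrow> 'a \<Rightarrow> 'b" where
  "fd f z \<equiv> frechet_derivative f (at z)"

abbreviation uncur :: "'n local_fun \<Rightarrow> (real ^ 'n) \<times> (real ^ 'n) \<Rightarrow> real" where
  "uncur f \<equiv> \<lambda>z. f (fst z) (snd z)"

lemma linear_sum_axis:
  fixes h :: "real ^ 'n \<Rightarrow> 'b::real_vector"
  assumes "linear h"
  shows "h v = (\<Sum>k\<in>UNIV. v $ k *\<^sub>R h (axis k 1))"
proof -
  have "h v = h (\<Sum>k\<in>UNIV. v $ k *\<^sub>R axis k 1)"
    using basis_expansion[of v] by (simp add: scalar_mult_eq_scaleR)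
  then show ?thesis
    by (simp add: linear_sum[OF assms] linear_scale[OF assms])
qed

lemma linear_eq_on_axes:
  fixes g h :: "real ^ 'n \<Rightarrow> 'b::real_vector"
  assumes "linear g" "linear h" "\<And>k. g (axis k 1) = h (axis k 1)"
  shows "g v = h v"
  using linear_sum_axis[OF assms(1), of v] linear_sum_axis[OF assms(2), of v] assms(3) by simp

lemma fd_cong:
  assumes "f differentiable (at x)" "open S" "x \<in> S" "\<And>z. z \<in> S \<Longrightarrow> f z = g z"
  shows "fd f x = fd g x"
  using frechet_derivative_transform_within_open[OF assms(1-4)] .

text \<open>Differentiation in a fixed direction preserves linearity in a parameter, by uniqueness
  of the derivative. This yields multilinearity of iterated derivatives.\<close>

lemma fd_family_linear:
  fixes g :: "'a::euclidean_space \<Rightarrow> 'e::euclidean_space \<Rightarrow> 'b::euclidean_space"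
  assumes S: "open S" "z \<in> S" and lin: "\<And>z. z \<in> S \<Longrightarrow> linear (g z)"
    and d: "\<And>w. (\<lambda>z. g z w) differentiable (at z)"
  shows "linear (\<lambda>w. fd (\<lambda>z. g z w) z v)"
proof (rule linearI)
  note hd = d[unfolded frechet_derivative_works]
  fix a b :: 'e and r :: real
  have "((\<lambda>z. g z (a + b)) has_derivative (\<lambda>v. fd (\<lambda>z. g z a) z v + fd (\<lambda>z. g z b) z v)) (at z)"
    by (rule has_derivative_transform_within_open[OF has_derivative_add[OF hd hd] S])
       (simp add: linear_add[OF lin])
  from fun_cong[OF frechet_derivative_at[OF this], of v] show "fd (\<lambda>z. g z (a + b)) z v = fd (\<lambda>z. g z a) z v + fd (\<lambda>z. g z b) z v"
    by simp
  have "((\<lambda>z. g z (r *\<^sub>R a)) has_derivative (\<lambda>v. r *\<^sub>R fd (\<lambda>z. g z a) z v)) (at z)"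
    by (rule has_derivative_transform_within_open[OF has_derivative_scaleR_right[OF hd] S])
       (simp add: linear_scale[OF lin])
  from fun_cong[OF frechet_derivative_at[OF this], of v] show "fd (\<lambda>z. g z (r *\<^sub>R a)) z v = r *\<^sub>R fd (\<lambda>z. g z a) z v"
    by simp
qed

text \<open>Product rule for a moving linear map applied to a moving vector. Differentiability of
  \<open>K\<close> is asked only at each fixed argument, so no normed space of operators is
  involved; finite dimension supplies the rest through a basis expansion.\<close>

lemma linear_family_has_derivative:
  fixes K :: "'a::real_normed_vector \<Rightarrow> 'e::euclidean_space \<Rightarrow> 'b::real_normed_vector"
  assumes S: "open S" "z \<in> S" and lin: "\<And>z. z \<in> S \<Longrightarrow> linear (K z)"
    and K: "\<And>e. ((\<lambda>z. K z e) has_derivative K' e) (at z)"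
    and m: "(m has_derivative m') (at z)"
  shows "((\<lambda>z. K z (m z)) has_derivative (\<lambda>w. K' (m z) w + K z (m' w))) (at z)"
proof -
  have expand: "K x v = (\<Sum>b\<in>Basis. (v \<bullet> b) *\<^sub>R K x b)" if "x \<in> S" for x v
    using linear_sum[OF lin[OF that], of "\<lambda>b. (v \<bullet> b) *\<^sub>R b" Basis]
    by (simp add: euclidean_representation linear_scale[OF lin[OF that]])
  have deriv: "((\<lambda>x. K x (m' x)) has_derivative (\<lambda>w. \<Sum>b\<in>Basis. (m' z \<bullet> b) *\<^sub>R K' b w + (m'' w \<bullet> b) *\<^sub>R K z b)) (at z)"
    if "(m' has_derivative m'') (at z)" for m' m''
    by (rule has_derivative_transform_within_open[OF has_derivative_sum S expand[symmetric]])
       (rule has_derivative_scaleR[OF has_derivative_inner_left[OF that] K])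
  \<comment> \<open>Feeding in a constant vector and using uniqueness shows that \<open>K'\<close>
    is itself linear in its first argument.\<close>
  have K': "K' v w = (\<Sum>b\<in>Basis. (v \<bullet> b) *\<^sub>R K' b w)" for v w
    using fun_cong[OF has_derivative_unique[OF K deriv[OF has_derivative_const[of v]]], of w] by simp
  show ?thesis
    using deriv[OF m] unfolding K'[of "m z"] expand[OF S(2), of "m' _"] by (simp add: sum.distrib)
qed

section \<open>Coordinate partials as directional derivatives\<close>

lemma dx_eq_fd:
  assumes "uncur f differentiable (at z)"
  shows "dx k f (fst z) (snd z) = fd (uncur f) z (axis k 1, 0)"
proof -
  note F = assms[unfolded frechet_derivative_works]
  have "((\<lambda>t. uncur f (fst z + t *\<^sub>R axis k 1, snd z)) has_derivative
     (\<lambda>t. fd (uncur f) z (t *\<^sub>R axis k 1, 0))) (at 0)"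
    by (rule has_derivative_compose[where g = "uncur f"])
       (auto intro!: derivative_eq_intros simp: F simp del: fst_conv snd_conv)
  moreover have "fd (uncur f) z (t *\<^sub>R axis k 1, 0) = t * fd (uncur f) z (axis k 1, 0)" for t
    using linear_scale[OF linear_frechet_derivative[OF assms], of t "(axis k 1, 0)"] by simp
  ultimately have "((\<lambda>t. f (fst z + t *\<^sub>R axis k 1) (snd z)) has_field_derivative
     fd (uncur f) z (axis k 1, 0)) (at 0)"
    by (simp add: has_field_derivative_def mult_commute_abs)
  then show ?thesis
    unfolding dx_def by (rule DERIV_imp_deriv)
qed

lemma dy_eq_fd:
  assumes "uncur f differentiable (at z)"
  shows "dy k f (fst z) (snd z) = fd (uncur f) z (0, axis k 1)"
proof -
  note F = assms[unfolded frechet_derivative_works]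
  have "((\<lambda>t. uncur f (fst z, snd z + t *\<^sub>R axis k 1)) has_derivative
     (\<lambda>t. fd (uncur f) z (0, t *\<^sub>R axis k 1))) (at 0)"
    by (rule has_derivative_compose[where g = "uncur f"])
       (auto intro!: derivative_eq_intros simp: F simp del: fst_conv snd_conv)
  moreover have "fd (uncur f) z (0, t *\<^sub>R axis k 1) = t * fd (uncur f) z (0, axis k 1)" for t
    using linear_scale[OF linear_frechet_derivative[OF assms], of t "(0, axis k 1)"] by simp
  ultimately have "((\<lambda>t. f (fst z) (snd z + t *\<^sub>R axis k 1)) has_field_derivative
     fd (uncur f) z (0, axis k 1)) (at 0)"
    by (simp add: has_field_derivative_def mult_commute_abs)
  then show ?thesis
    unfolding dy_def by (rule DERIV_imp_deriv)
qed

lemma dx_eq_fd_on: "smooth_on S (uncur f) \<Longrightarrow> z \<in> S \<Longrightarrow> dx k f (fst z) (snd z) = fd (uncur f) z (axis k 1, 0)"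
  by (rule dx_eq_fd[OF smooth_on_imp_differentiable])

lemma dy_eq_fd_on: "smooth_on S (uncur f) \<Longrightarrow> z \<in> S \<Longrightarrow> dy k f (fst z) (snd z) = fd (uncur f) z (0, axis k 1)"
  by (rule dy_eq_fd[OF smooth_on_imp_differentiable])

lemma smooth_on_dx:
  assumes "open S" "smooth_on S (uncur f)"
  shows "smooth_on S (uncur (dx k f))"
  by (rule smooth_on_cong[OF assms(1) dx_eq_fd_on[OF assms(2), symmetric] smooth_on_derivative[OF assms(2)]])

lemma smooth_on_dy:
  assumes "open S" "smooth_on S (uncur f)"
  shows "smooth_on S (uncur (dy k f))"
  by (rule smooth_on_cong[OF assms(1) dy_eq_fd_on[OF assms(2), symmetric] smooth_on_derivative[OF assms(2)]])

lemma fd_vec_nth: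
  assumes "g differentiable (at z)"
  shows "fd g z v $ i = fd (\<lambda>z. g z $ (i::'n::finite) :: real) z v"
  using frechet_derivative_linear_compose[OF assms bounded_linear_vec_nth] by metis

lemma fd_horizontal_sum:
  fixes L :: "(real ^ 'n) \<times> (real ^ 'n) \<Rightarrow> 'b::real_normed_vector"
  assumes "L differentiable (at z)"
  shows "fd L z (v, 0) = (\<Sum>k\<in>UNIV. v $ k *\<^sub>R fd L z (axis k 1, 0))"
proof -
  interpret linear "fd L z" by (rule linear_frechet_derivative[OF assms])
  have "linear (\<lambda>v. fd L z (v, 0))"
    by (rule linearI) (use add[of "(_,0)" "(_,0)"] scale[of _ "(_,0)"] in auto)
  then show ?thesis by (rule linear_sum_axis)
qed

lemma linear_fd_vertical:
  fixes L :: "'a::real_normed_vector \<times> 'c::real_normed_vector \<Rightarrow> 'b::real_normed_vector"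
  assumes "L differentiable (at z)"
  shows "linear (\<lambda>v. fd L z (0, v))"
proof -
  interpret linear "fd L z" by (rule linear_frechet_derivative[OF assms])
  show ?thesis
    by (rule linearI) (use add[of "(0,_)" "(0,_)"] scale[of _ "(0,_)"] in auto)
qed

lemma fd_vertical_sum:
  fixes L :: "(real ^ 'n) \<times> (real ^ 'n) \<Rightarrow> 'b::real_normed_vector"
  assumes "L differentiable (at z)"
  shows "fd L z (0, v) = (\<Sum>k\<in>UNIV. v $ k *\<^sub>R fd L z (0, axis k 1))"
  by (rule linear_sum_axis[OF linear_fd_vertical[OF assms]])

lemma fd_split:
  assumes "L differentiable (at z)"
  shows "fd L z (u, v) = fd L z (u, 0) + fd L z (0, v)"
  using linear_add[OF linear_frechet_derivative[OF assms], of "(u, 0)" "(0, v)"] by simp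

lemma vertical_has_derivative:
  assumes "L differentiable (at (x, y))"
  shows "((\<lambda>y. L (x, y)) has_derivative (\<lambda>v. fd L (x, y) (0, v))) (at y)"
  by (rule has_derivative_compose[where f = "\<lambda>y. (x, y)", OF _ assms[unfolded frechet_derivative_works]])
     (auto intro!: derivative_eq_intros)

lemma
  fixes A :: "'a::semiring_1 ^ 'n ^ 'm"
  assumes "invertible A"
  shows matrix_inv_right: "A ** matrix_inv A = mat 1" and matrix_inv_left: "matrix_inv A ** A = mat 1"
  using someI_ex[OF assms[unfolded invertible_def]] unfolding matrix_inv_def by auto

lemma smooth_on_snd_nth:
  "open (S :: ('a::euclidean_space \<times> (real ^ 'n)) set) \<Longrightarrow> smooth_on S (\<lambda>z. snd z $ i)"
  by (rule smooth_on_linear) (auto intro: bounded_linear_compose[OF bounded_linear_vec_nth] bounded_linear_snd)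

text \<open>Applied repeatedly, it matches iterated \<open>dy\<close> of the components with
  iterated vertical derivatives of the vector.\<close>

lemma vertical_derivative_vec:
  fixes h :: "'n::finite \<Rightarrow> 'n local_fun"
  assumes S: "open S" and h: "\<And>i. smooth_on S (uncur (h i))"
    and g: "\<And>z. z \<in> S \<Longrightarrow> g z = (\<chi> i. uncur (h i) z)" and z: "z \<in> S"
  shows "fd g z (0, axis l 1) = (\<chi> i. uncur (dy l (h i)) z)"
proof -
  let ?g = "\<lambda>z. \<chi> i. uncur (h i) z"
  have sm: "smooth_on S ?g" by (rule smooth_on_vec[OF S h])
  have "fd g z = fd ?g z"
    using fd_cong[OF smooth_on_imp_differentiable[OF sm z] S z, of g] g by simp
  moreover have "fd ?g z (0, axis l 1) $ i = uncur (dy l (h i)) z" for i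
    using fd_vec_nth[OF smooth_on_imp_differentiable[OF sm z]] dy_eq_fd_on[OF h z] by simp
  ultimately show ?thesis by (simp add: vec_eq_iff)
qed

section \<open>The spray and its connection\<close>

locale nondegenerate_metric =
  fixes S :: "((real ^ 'n) \<times> (real ^ 'n)) set" and f :: "'n::finite local_fun"
  assumes open_S: "open S"
    and smooth_f: "smooth_on S (uncur f)"
    and invertible_fund: "\<And>z. z \<in> S \<Longrightarrow> invertible (fund_tensor f (fst z) (snd z))"
begin

definition L :: "(real ^ 'n) \<times> (real ^ 'n) \<Rightarrow> real" where
  "L = uncur (\<lambda>x y. (f x y)\<^sup>2)"

lemma smooth_L: "smooth_on S L"
  unfolding L_def power2_eq_square by (intro smooth_on_mult open_S smooth_f)

lemma smooth_f2: "smooth_on S (uncur (\<lambda>x y. (f x y)\<^sup>2))"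
  using smooth_L by (simp add: L_def)

lemma fd_dy_f2:
  assumes "z \<in> S"
  shows "fd (uncur (dy j (\<lambda>x y. (f x y)\<^sup>2))) z = fd (\<lambda>z. fd L z (0, axis j 1)) z"
  unfolding L_def
  by (rule fd_cong[OF smooth_on_imp_differentiable[OF smooth_on_dy[OF open_S smooth_f2]] open_S, OF assms assms])
     (rule dy_eq_fd_on[OF smooth_f2])

lemma fund_eq:
  assumes "z \<in> S"
  shows "fund_tensor f (fst z) (snd z) $ i $ j = 1/2 * fd (\<lambda>z. fd L z (0, axis j 1)) z (0, axis i 1)"
  using dy_eq_fd_on[OF smooth_on_dy[OF open_S smooth_f2] assms, of i j]
  by (simp add: fund_tensor_def fd_dy_f2[OF assms])

lemma fund_sym:
  assumes "z \<in> S"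
  shows "fund_tensor f (fst z) (snd z) $ i $ j = fund_tensor f (fst z) (snd z) $ j $ i"
  unfolding fund_eq[OF assms] using second_derivative_symmetric[OF smooth_L open_S assms] by simp

lemma vertical_second_derivative:
  assumes "z \<in> S"
  shows "fd (\<lambda>z. fd L z (0, axis j 1)) z (0, axis k 1) = 2 * fund_tensor f (fst z) (snd z) $ j $ k"
  using fund_eq[OF assms, of k j] fund_sym[OF assms, of j k] by simp

section \<open>Smoothness of the spray and its Euler-Lagrange equations\<close>

definition spray_vec :: "(real ^ 'n) \<times> (real ^ 'n) \<Rightarrow> real ^ 'n" where
  "spray_vec z = (\<chi> i. uncur (spray f i) z)"

lemma smooth_fund: "smooth_on S (\<lambda>z. fund_tensor f (fst z) (snd z) $ i $ j)"
  unfolding fund_tensor_def vec_lambda_beta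
  by (intro smooth_on_mult smooth_on_const smooth_on_dy open_S smooth_f2)

text \<open>\<open>matrix_inv\<close> is defined by choice, so smoothness is read off Cramer's rule:
  column \<open>l\<close> of the inverse solves the system with right-hand side
  \<open>axis l 1\<close>, and its entries are quotients of determinants.\<close>

lemma smooth_matrix_inv_fund:
  "smooth_on S (\<lambda>z. matrix_inv (fund_tensor f (fst z) (snd z)) $ i $ l)"
proof -
  let ?g = "\<lambda>z. fund_tensor f (fst z) (snd z)"
  let ?c = "\<lambda>z. \<chi> p q. if q = i then axis l 1 $ p else ?g z $ p $ q"
  have det: "det (?g z) \<noteq> 0" if "z \<in> S" for z
    using invertible_fund[OF that] by (simp add: invertible_det_nz)
  have "?g z = (\<chi> p q. ?g z $ p $ q)" for z by (simp add: vec_eq_iff)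
  then have smooth_det: "smooth_on S (\<lambda>z. det (?g z))"
    using smooth_on_det[OF open_S, of "\<lambda>i j z. ?g z $ i $ j"] smooth_fund by simp
  have "smooth_on S (\<lambda>z. det (?c z))"
  proof (rule smooth_on_det[OF open_S])
    show "smooth_on S (\<lambda>z. if q = i then axis l 1 $ p else ?g z $ p $ q)" for p q
      by (cases "q = i") (simp_all add: smooth_on_const open_S smooth_fund)
  qed
  from smooth_on_divide[OF open_S this smooth_det det]
  have "smooth_on S (\<lambda>z. det (?c z) / det (?g z))" .
  moreover have "det (?c z) / det (?g z) = matrix_inv (?g z) $ i $ l" if "z \<in> S" for z
  proof -
    have "?g z *v (matrix_inv (?g z) *v axis l 1) = axis l 1"
      using matrix_inv_right[OF invertible_fund[OF that]] by (simp add: matrix_vector_mul_assoc)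
    then have "matrix_inv (?g z) *v axis l 1 = (\<chi> k. det (\<chi> p q. if q = k then axis l 1 $ p else ?g z $ p $ q) / det (?g z))"
      using cramer[OF det[OF that]] by blast
    from arg_cong[OF this, of "\<lambda>v. v $ i"] show ?thesis
      by (simp add: matrix_vector_mult_basis column_def)
  qed
  ultimately show ?thesis by (rule smooth_on_cong[OF open_S, rotated])
qed

lemma smooth_spray: "smooth_on S (uncur (spray f i))"
  unfolding spray_def
  by (intro smooth_on_mult smooth_on_const smooth_on_sum smooth_on_diff smooth_on_dx smooth_on_dy
      smooth_matrix_inv_fund smooth_on_snd_nth open_S smooth_f2)

lemma smooth_spray_vec: "smooth_on S spray_vec"
  unfolding spray_vec_def by (rule smooth_on_vec[OF open_S smooth_spray])

lemma linear_vertical_L: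
  assumes "z \<in> S" shows "linear (\<lambda>v. fd (\<lambda>z. fd L z (0, v)) z w)"
  by (rule fd_family_linear[OF open_S assms linear_fd_vertical])
     (auto intro: smooth_on_imp_differentiable smooth_on_derivative smooth_L assms)

lemma spray_lower:
  assumes "z \<in> S"
  shows "4 * (\<Sum>i\<in>UNIV. fund_tensor f (fst z) (snd z) $ l $ i * spray_vec z $ i)
    = (\<Sum>k\<in>UNIV. uncur (dx k (dy l (\<lambda>x y. (f x y)\<^sup>2))) z * snd z $ k) - uncur (dx l (\<lambda>x y. (f x y)\<^sup>2)) z"
proof -
  let ?g = "fund_tensor f (fst z) (snd z)"
  define E where "E = (\<chi> l. (\<Sum>k\<in>UNIV. uncur (dx k (dy l (\<lambda>x y. (f x y)\<^sup>2))) z * snd z $ k) - uncur (dx l (\<lambda>x y. (f x y)\<^sup>2)) z)"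
  have "4 *\<^sub>R spray_vec z = matrix_inv ?g *v E"
    by (simp add: spray_vec_def spray_def vec_eq_iff matrix_vector_mult_def E_def)
  then have "?g *v (4 *\<^sub>R spray_vec z) = E"
    using matrix_inv_right[OF invertible_fund[OF assms]] by (simp add: matrix_vector_mul_assoc)
  from arg_cong[OF this, of "\<lambda>v. v $ l"] show ?thesis
    by (simp add: matrix_vector_mult_def E_def sum_distrib_left algebra_simps)
qed

text \<open>This is the defining formula of the spray with its index lowered: along curves with
  \<open>x'' = -2 G\<close>, the time derivative of the momentum equals the
  \<open>x\<close>-derivative of \<open>L\<close>. The form is free of indices and of the inverse
  matrix, so it can be carried through a change of coordinates.\<close>

lemma spray_Euler_Lagrange:
  assumes "z \<in> S"
  shows "fd (\<lambda>z. fd L z (0, v)) z (snd z, - 2 *\<^sub>R spray_vec z) = fd L z (v, 0)"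
proof (rule linear_eq_on_axes[where v = v and h = "\<lambda>v. fd L z (v, 0)"])
  show "linear (\<lambda>v. fd (\<lambda>z. fd L z (0, v)) z (snd z, - 2 *\<^sub>R spray_vec z))"
    by (rule linear_vertical_L[OF assms])
  interpret linear "fd L z" by (rule smooth_on_linear_derivative[OF smooth_L assms])
  show "linear (\<lambda>v. fd L z (v, 0))"
    by (rule linearI) (use add[of "(_,0)" "(_,0)"] scale[of _ "(_,0)"] in auto)
  fix l
  let ?D = "\<lambda>z. fd L z (0, axis l 1)"
  have d: "?D differentiable (at z)"
    by (rule smooth_on_imp_differentiable[OF smooth_on_derivative[OF smooth_L] assms])
  have "fd ?D z (snd z, - 2 *\<^sub>R spray_vec z)
      = (\<Sum>k\<in>UNIV. snd z $ k * fd ?D z (axis k 1, 0)) + (\<Sum>k\<in>UNIV. (- 2 * spray_vec z $ k) * fd ?D z (0, axis k 1))"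
    unfolding fd_split[OF d, of "snd z" "- 2 *\<^sub>R spray_vec z"] fd_horizontal_sum[OF d, of "snd z"]
      fd_vertical_sum[OF d, of "- 2 *\<^sub>R spray_vec z"] by simp
  also have "(\<Sum>k\<in>UNIV. snd z $ k * fd ?D z (axis k 1, 0))
      = (\<Sum>k\<in>UNIV. uncur (dx k (dy l (\<lambda>x y. (f x y)\<^sup>2))) z * snd z $ k)"
    unfolding dx_eq_fd_on[OF smooth_on_dy[OF open_S smooth_f2] assms] fd_dy_f2[OF assms]
    by (rule sum.cong[OF refl mult.commute])
  \<comment> \<open>One factor 2 comes from the direction \<open>- 2 *\<^sub>R spray_vec z\<close>,
    the other from the vertical Hessian of \<open>L\<close> being twice the fundamental
    tensor.\<close>
  also have "(\<Sum>k\<in>UNIV. (- 2 * spray_vec z $ k) * fd ?D z (0, axis k 1))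
      = - (4 * (\<Sum>i\<in>UNIV. fund_tensor f (fst z) (snd z) $ l $ i * spray_vec z $ i))"
  proof -
    have "(- 2 * spray_vec z $ k) * fd ?D z (0, axis k 1)
        = - (4 * (fund_tensor f (fst z) (snd z) $ l $ k * spray_vec z $ k))" for k
      by (simp add: vertical_second_derivative[OF assms])
    then show ?thesis by (simp only: sum_negf sum_distrib_left)
  qed
  finally show "fd ?D z (snd z, - 2 *\<^sub>R spray_vec z) = fd L z (axis l 1, 0)"
    using spray_lower[OF assms, of l] dx_eq_fd_on[OF smooth_f2 assms, of l] by (simp add: L_def)
qed

lemma vertical_Hessian_nondegenerate:
  assumes "z \<in> S" and "\<And>v. fd (\<lambda>z. fd L z (0, v)) z (0, h) = 0"
  shows "h = 0"
proof -
  let ?g = "fund_tensor f (fst z) (snd z)"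
  have "(?g *v h) $ j = 0" for j
  proof -
    have d: "(\<lambda>z. fd L z (0, axis j 1)) differentiable (at z)"
      by (rule smooth_on_imp_differentiable[OF smooth_on_derivative[OF smooth_L] assms(1)])
    have "0 = (\<Sum>k\<in>UNIV. h $ k * fd (\<lambda>z. fd L z (0, axis j 1)) z (0, axis k 1))"
      using assms(2)[of "axis j 1"] fd_vertical_sum[OF d, of h] by simp
    also have "\<dots> = 2 * (?g *v h) $ j"
      by (simp add: vertical_second_derivative[OF assms(1)] matrix_vector_mult_def sum_distrib_left algebra_simps)
    finally show ?thesis by simp
  qed
  then have "?g *v h = 0" by (simp add: vec_eq_iff)
  then show ?thesis
    using matrix_inv_left[OF invertible_fund[OF assms(1)]]
    by (metis matrix_vector_mul_assoc matrix_vector_mul_lid matrix_vector_mult_0_right)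
qed

text \<open>Two solutions differ by a vector in the kernel of the vertical Hessian. A candidate for
  the spray in new coordinates therefore only has to satisfy the equations.\<close>

lemma spray_unique:
  assumes "z \<in> S" and "\<And>v. fd (\<lambda>z. fd L z (0, v)) z (snd z, - 2 *\<^sub>R G) = fd L z (v, 0)"
  shows "spray_vec z = G"
proof -
  have "fd (\<lambda>z. fd L z (0, v)) z (0, 2 *\<^sub>R (spray_vec z - G)) = 0" for v
  proof -
    have "linear (fd (\<lambda>z. fd L z (0, v)) z)"
      by (rule smooth_on_linear_derivative[OF smooth_on_derivative[OF smooth_L] assms(1)])
    from linear_diff[OF this, of "(snd z, - 2 *\<^sub>R G)" "(snd z, - 2 *\<^sub>R spray_vec z)"]
    show ?thesis
      using assms(2)[of v] spray_Euler_Lagrange[OF assms(1), of v] by (simp add: algebra_simps)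
  qed
  from vertical_Hessian_nondegenerate[OF assms(1) this] show ?thesis by simp
qed

end

section \<open>Tensors as trilinear maps\<close>

definition trilinear :: "('a::real_vector \<Rightarrow> 'a \<Rightarrow> 'a \<Rightarrow> 'b::real_vector) \<Rightarrow> bool" where
  "trilinear t \<longleftrightarrow> (\<forall>v w. linear (\<lambda>u. t u v w)) \<and> (\<forall>u w. linear (\<lambda>v. t u v w)) \<and> (\<forall>u v. linear (t u v))"

lemma trilinear_eq_on_axes:
  fixes s t :: "real ^ 'n \<Rightarrow> real ^ 'n \<Rightarrow> real ^ 'n \<Rightarrow> 'b::real_vector"
  assumes "trilinear s" "trilinear t"
    and "\<And>j k l. s (axis j 1) (axis k 1) (axis l 1) = t (axis j 1) (axis k 1) (axis l 1)"
  shows "s u v w = t u v w"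
proof -
  note s = assms(1)[unfolded trilinear_def] and t = assms(2)[unfolded trilinear_def]
  have 1: "s u (axis k 1) (axis l 1) = t u (axis k 1) (axis l 1)" for u k l
    by (rule linear_eq_on_axes[of "\<lambda>u. s u (axis k 1) (axis l 1)" "\<lambda>u. t u (axis k 1) (axis l 1)"])
       (use s t assms(3) in auto)
  have 2: "s u v (axis l 1) = t u v (axis l 1)" for u v l
    by (rule linear_eq_on_axes[of "\<lambda>v. s u v (axis l 1)" "\<lambda>v. t u v (axis l 1)"])
       (use s t 1 in auto)
  show ?thesis
    by (rule linear_eq_on_axes[of "s u v" "t u v"]) (use s t 2 in auto)
qed

lemma trilinear_add: "trilinear s \<Longrightarrow> trilinear t \<Longrightarrow> trilinear (\<lambda>u v w. s u v w + t u v w)"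
  unfolding trilinear_def by (auto intro: linear_compose_add)

lemma trilinear_diff: "trilinear s \<Longrightarrow> trilinear t \<Longrightarrow> trilinear (\<lambda>u v w. s u v w - t u v w)"
  unfolding trilinear_def by (auto intro: linear_compose_sub)

lemma trilinear_compose_left: "trilinear t \<Longrightarrow> linear h \<Longrightarrow> trilinear (\<lambda>u v w. h (t u v w))"
  unfolding trilinear_def using linear_compose[of _ h, unfolded o_def] by blast

lemma trilinear_compose1: "trilinear t \<Longrightarrow> linear h \<Longrightarrow> trilinear (\<lambda>u v w. t (h u) v w)"
  unfolding trilinear_def by (auto intro: linear_compose[of h, unfolded o_def])

lemma trilinear_compose2: "trilinear t \<Longrightarrow> linear h \<Longrightarrow> trilinear (\<lambda>u v w. t u (h v) w)"
  unfolding trilinear_def by (auto intro: linear_compose[of h, unfolded o_def])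

lemma trilinear_compose3: "trilinear t \<Longrightarrow> linear h \<Longrightarrow> trilinear (\<lambda>u v w. t u v (h w))"
  unfolding trilinear_def by (auto intro: linear_compose[of h, unfolded o_def])

text \<open>The slots are the lower indices \<open>j\<close>, \<open>k\<close>, \<open>l\<close>;
  the upper index becomes the component of the value. Covariance is then an identity between maps
  instead of a multiple sum of Jacobian entries.\<close>

definition tens :: "'n::finite local_tensor13 \<Rightarrow> (real ^ 'n) \<times> (real ^ 'n)
    \<Rightarrow> real ^ 'n \<Rightarrow> real ^ 'n \<Rightarrow> real ^ 'n \<Rightarrow> real ^ 'n" where
  "tens T z u v w = (\<chi> i. \<Sum>j\<in>UNIV. \<Sum>k\<in>UNIV. \<Sum>l\<in>UNIV. uncur (T j i k l) z * u $ j * v $ k * w $ l)"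

lemma trilinear_tens: "trilinear (tens T z)"
  unfolding trilinear_def tens_def
  by (auto intro!: linearI simp: vec_eq_iff algebra_simps sum.distrib sum_distrib_left)

lemma tens_axis: "tens T z (axis j 1) (axis k 1) (axis l 1) $ i = uncur (T j i k l) z"
  by (simp add: tens_def axis_def if_distrib[of "\<lambda>x. _ * x"] if_distrib[of "\<lambda>x. x * _"] sum.delta cong: if_cong)

lemma tens_axis1: "tens T z a (axis k 1) (axis l 1) $ i = (\<Sum>r\<in>UNIV. uncur (T r i k l) z * a $ r)"
  using linear_sum_axis[of "\<lambda>a. tens T z a (axis k 1) (axis l 1)" a] trilinear_tens[of T z]
  by (simp add: trilinear_def tens_axis mult.commute)

lemma tens_axis2: "tens T z (axis j 1) a (axis l 1) $ i = (\<Sum>r\<in>UNIV. uncur (T j i r l) z * a $ r)"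
  using linear_sum_axis[of "\<lambda>a. tens T z (axis j 1) a (axis l 1)" a] trilinear_tens[of T z]
  by (simp add: trilinear_def tens_axis mult.commute)

lemma tens_axis3: "tens T z (axis j 1) (axis k 1) a $ i = (\<Sum>r\<in>UNIV. uncur (T j i k r) z * a $ r)"
  using linear_sum_axis[of "\<lambda>a. tens T z (axis j 1) (axis k 1) a" a] trilinear_tens[of T z]
  by (simp add: trilinear_def tens_axis mult.commute)

lemma smooth_tens:
  assumes "open S" "\<And>i j k l. smooth_on S (uncur (T j i k l))"
  shows "smooth_on S (\<lambda>z. tens T z u v w)"
  unfolding tens_def
  by (intro smooth_on_vec smooth_on_sum smooth_on_mult smooth_on_const assms)

context nondegenerate_metric
begin

text \<open>The nonlinear connection \<open>G^i_{.m} v^m\<close>; its own vertical derivative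
  \<open>berwald\<close> gives the Berwald connection coefficients
  \<open>G^i_{.r.m}\<close>.\<close>

definition nonlin :: "(real ^ 'n) \<times> (real ^ 'n) \<Rightarrow> real ^ 'n \<Rightarrow> real ^ 'n" where
  "nonlin z v = fd spray_vec z (0, v)"

definition berwald :: "(real ^ 'n) \<times> (real ^ 'n) \<Rightarrow> real ^ 'n \<Rightarrow> real ^ 'n \<Rightarrow> real ^ 'n" where
  "berwald z v w = fd (\<lambda>z. nonlin z w) z (0, v)"

text \<open>\<open>cov t\<close> is the covariant derivative along the vector field \<open>y\<^sup>m (\<partial>\<^sub>x\<^sub>m - G\<^sup>r\<^sub>.\<^sub>m \<partial>\<^sub>y\<^sub>r)\<close>.\<close>

definition cov :: "((real ^ 'n) \<times> (real ^ 'n) \<Rightarrow> real ^ 'n \<Rightarrow> real ^ 'n \<Rightarrow> real ^ 'n \<Rightarrow> real ^ 'n)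
    \<Rightarrow> (real ^ 'n) \<times> (real ^ 'n) \<Rightarrow> real ^ 'n \<Rightarrow> real ^ 'n \<Rightarrow> real ^ 'n \<Rightarrow> real ^ 'n" where
  "cov t z u v w = fd (\<lambda>z. t z u v w) z (snd z, - nonlin z (snd z)) + berwald z (snd z) (t z u v w)
     - t z (berwald z (snd z) u) v w - t z u (berwald z (snd z) v) w - t z u v (berwald z (snd z) w)"

lemma smooth_nonlin: "smooth_on S (\<lambda>z. nonlin z v)"
  unfolding nonlin_def by (rule smooth_on_derivative[OF smooth_spray_vec])

lemma linear_nonlin: "z \<in> S \<Longrightarrow> linear (nonlin z)"
  unfolding nonlin_def by (rule linear_fd_vertical[OF smooth_on_imp_differentiable[OF smooth_spray_vec]])

lemma linear_berwald1: "z \<in> S \<Longrightarrow> linear (\<lambda>v. berwald z v w)"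
  unfolding berwald_def by (rule linear_fd_vertical[OF smooth_on_imp_differentiable[OF smooth_nonlin]])

lemma linear_berwald2: "z \<in> S \<Longrightarrow> linear (berwald z v)"
  unfolding berwald_def
  by (rule fd_family_linear[OF open_S _ linear_nonlin smooth_on_imp_differentiable[OF smooth_nonlin]])

lemma nonlin_axis: "z \<in> S \<Longrightarrow> nonlin z (axis m 1) = (\<chi> i. uncur (dy m (spray f i)) z)"
  unfolding nonlin_def by (rule vertical_derivative_vec[OF open_S smooth_spray]) (auto simp: spray_vec_def)

lemma berwald_axis:
  "z \<in> S \<Longrightarrow> berwald z (axis m 1) (axis r 1) = (\<chi> i. uncur (dy m (dy r (spray f i))) z)"
  unfolding berwald_def
  by (rule vertical_derivative_vec[OF open_S smooth_on_dy[OF open_S smooth_spray] nonlin_axis])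

lemma nonlin_nth: "z \<in> S \<Longrightarrow> nonlin z v $ i = (\<Sum>m\<in>UNIV. v $ m * uncur (dy m (spray f i)) z)"
  using linear_sum_axis[OF linear_nonlin, of z v] by (simp add: nonlin_axis)

lemma berwald_nth:
  "z \<in> S \<Longrightarrow> berwald z v (axis r 1) $ i = (\<Sum>m\<in>UNIV. v $ m * uncur (dy m (dy r (spray f i))) z)"
  using linear_sum_axis[OF linear_berwald1, of z v "axis r 1"] by (simp add: berwald_axis)

lemma berwald_nth2:
  assumes "z \<in> S"
  shows "berwald z v w $ i = (\<Sum>r\<in>UNIV. w $ r * berwald z v (axis r 1) $ i)"
  using linear_sum_axis[OF linear_berwald2[OF assms], of v w] by simp

text \<open>Trilinearity of \<open>t\<close> is assumed on all of \<open>S\<close> because the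
  derivative term sees the points near \<open>z\<close>.\<close>

lemma trilinear_cov:
  assumes "z \<in> S" and t: "\<And>z. z \<in> S \<Longrightarrow> trilinear (t z)"
    and sm: "\<And>u v w. smooth_on S (\<lambda>z. t z u v w)"
  shows "trilinear (cov t z)"
proof -
  note d = smooth_on_imp_differentiable[OF sm assms(1)]
  have "trilinear (\<lambda>u v w. fd (\<lambda>z. t z u v w) z h)" for h
    using t unfolding trilinear_def by (auto intro!: fd_family_linear[OF open_S assms(1) _ d])
  then show ?thesis
    unfolding cov_def
    by (intro trilinear_diff trilinear_add trilinear_compose_left[OF t] trilinear_compose1[OF t]
        trilinear_compose2[OF t] trilinear_compose3[OF t] linear_berwald2 assms(1))
qed

text \<open>Both sides are trilinear, so axis vectors suffice. There the contraction with
  \<open>y\<close> can be pulled inside every term, leaving one derivative along the horizontal lift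
  of \<open>y\<close> and the Berwald maps in direction \<open>y\<close>.\<close>

lemma tens_hderiv0:
  assumes T: "\<And>i j k l. smooth_on S (uncur (T j i k l))" and z: "z \<in> S"
  shows "tens (hderiv0 f T) z u v w = cov (tens T) z u v w"
proof (rule trilinear_eq_on_axes[OF trilinear_tens trilinear_cov[OF z trilinear_tens smooth_tens[OF open_S T]]])
  fix j k l
  let ?y = "snd z"
  have "tens (hderiv0 f T) z (axis j 1) (axis k 1) (axis l 1) $ i
      = cov (tens T) z (axis j 1) (axis k 1) (axis l 1) $ i" for i
  proof -
    let ?\<tau> = "uncur (T j i k l)"
    have swap: "(\<Sum>m\<in>UNIV. (\<Sum>r\<in>UNIV. a r * b m r) * ?y $ m) = (\<Sum>r\<in>UNIV. a r * (\<Sum>m\<in>UNIV. ?y $ m * b m r))"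
      for a :: "'n \<Rightarrow> real" and b
      unfolding sum_distrib_left sum_distrib_right by (subst sum.swap) (simp add: mult_ac)
    have d: "?\<tau> differentiable (at z)" by (rule smooth_on_imp_differentiable[OF T z])
    have comp: "(\<lambda>z. tens T z (axis j 1) (axis k 1) (axis l 1) $ i) = ?\<tau>"
      by (rule ext) (rule tens_axis)
    have "fd (\<lambda>z. tens T z (axis j 1) (axis k 1) (axis l 1)) z (?y, - nonlin z ?y) $ i
        = fd ?\<tau> z (?y, - nonlin z ?y)"
      unfolding fd_vec_nth[OF smooth_on_imp_differentiable[OF smooth_tens[OF open_S T] z]] comp ..
    also have "\<dots> = (\<Sum>m\<in>UNIV. ?y $ m * fd ?\<tau> z (axis m 1, 0)) - (\<Sum>r\<in>UNIV. nonlin z ?y $ r * fd ?\<tau> z (0, axis r 1))"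
      unfolding fd_split[OF d, of ?y "- nonlin z ?y"] fd_horizontal_sum[OF d, of ?y]
        fd_vertical_sum[OF d, of "- nonlin z ?y"]
      by (simp only: vector_uminus_component real_scaleR_def mult_minus_left sum_negf diff_conv_add_uminus)
    also have "\<dots> = (\<Sum>m\<in>UNIV. uncur (dx m (T j i k l)) z * ?y $ m)
        - (\<Sum>r\<in>UNIV. uncur (dy r (T j i k l)) z * nonlin z ?y $ r)"
      by (simp add: dx_eq_fd[OF d] dy_eq_fd[OF d] mult.commute)
    finally have 1: "fd (\<lambda>z. tens T z (axis j 1) (axis k 1) (axis l 1)) z (?y, - nonlin z ?y) $ i = \<dots>" .
    have "berwald z ?y (tens T z (axis j 1) (axis k 1) (axis l 1)) $ i
      = (\<Sum>r\<in>UNIV. uncur (T j r k l) z * berwald z ?y (axis r 1) $ i)"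
      unfolding berwald_nth2[OF z, of ?y "tens _ _ _ _ _"] by (simp add: tens_axis)
    then have 2: "cov (tens T) z (axis j 1) (axis k 1) (axis l 1) $ i
      = (\<Sum>m\<in>UNIV. uncur (dx m (T j i k l)) z * ?y $ m)
        - (\<Sum>r\<in>UNIV. uncur (dy r (T j i k l)) z * nonlin z ?y $ r)
        + (\<Sum>r\<in>UNIV. uncur (T j r k l) z * berwald z ?y (axis r 1) $ i)
        - (\<Sum>r\<in>UNIV. uncur (T r i k l) z * berwald z ?y (axis j 1) $ r)
        - (\<Sum>r\<in>UNIV. uncur (T j i r l) z * berwald z ?y (axis k 1) $ r)
        - (\<Sum>r\<in>UNIV. uncur (T j i k r) z * berwald z ?y (axis l 1) $ r)"
      by (simp add: cov_def 1 tens_axis1 tens_axis2 tens_axis3)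
    show ?thesis
      unfolding 2 tens_axis
      by (simp add: hderiv0_def berwald_hderiv_def left_diff_distrib distrib_right sum.distrib sum_subtractf
          nonlin_nth[OF z] berwald_nth[OF z] swap[symmetric] mult.commute[of "dy _ (spray f _) _ _"])
  qed
  then show "tens (hderiv0 f T) z (axis j 1) (axis k 1) (axis l 1)
      = cov (tens T) z (axis j 1) (axis k 1) (axis l 1)"
    by (simp add: vec_eq_iff)
qed

lemma smooth_hderiv0:
  assumes "\<And>i j k l. smooth_on S (uncur (T j i k l))"
  shows "smooth_on S (uncur (hderiv0 f T j i k l))"
  unfolding hderiv0_def berwald_hderiv_def
  by (intro smooth_on_sum smooth_on_mult smooth_on_diff smooth_on_add smooth_on_dx smooth_on_dy
      smooth_spray smooth_on_snd_nth open_S assms)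

section \<open>The Douglas tensor\<close>

text \<open>The projectively invariant part of the spray.\<close>

definition proj :: "(real ^ 'n) \<times> (real ^ 'n) \<Rightarrow> real ^ 'n" where
  "proj z = spray_vec z - (1 / (real CARD('n) + 1) * trace (matrix (nonlin z))) *\<^sub>R snd z"

abbreviation proj_coeff :: "'n \<Rightarrow> 'n local_fun" where
  "proj_coeff i \<equiv> \<lambda>x y. spray f i x y - 1 / (real CARD('n) + 1) * (\<Sum>m\<in>UNIV. dy m (spray f m) x y) * y $ i"

definition douglas_map :: "(real ^ 'n) \<times> (real ^ 'n) \<Rightarrow> real ^ 'n \<Rightarrow> real ^ 'n \<Rightarrow> real ^ 'n \<Rightarrow> real ^ 'n" where
  "douglas_map z u v w = fd (\<lambda>z. fd (\<lambda>z. fd proj z (0, w)) z (0, v)) z (0, u)"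

lemma smooth_proj_coeff: "smooth_on S (uncur (proj_coeff i))"
  by (intro smooth_on_sum smooth_on_mult smooth_on_diff smooth_on_const smooth_on_dy
      smooth_spray smooth_on_snd_nth open_S)

lemma proj_eq: "z \<in> S \<Longrightarrow> proj z = (\<chi> i. uncur (proj_coeff i) z)"
  by (simp add: proj_def vec_eq_iff spray_vec_def trace_def matrix_def nonlin_axis)

lemma smooth_proj: "smooth_on S proj"
  by (rule smooth_on_cong[OF open_S proj_eq[symmetric] smooth_on_vec[OF open_S smooth_proj_coeff]])

lemma smooth_douglas: "smooth_on S (uncur (douglas f j i k l))"
  unfolding douglas_def by (intro smooth_on_dy open_S smooth_proj_coeff)

text \<open>The slot \<open>u\<close> is the direction of the last derivative; the slots
  \<open>v\<close> and \<open>w\<close> sit inside it, and their linearity survives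
  differentiation.\<close>

lemma trilinear_douglas_map:
  assumes "z \<in> S" shows "trilinear (douglas_map z)"
proof -
  have 1: "smooth_on S (\<lambda>z. fd proj z (0, w))" for w
    by (rule smooth_on_derivative[OF smooth_proj])
  have 2: "smooth_on S (\<lambda>z. fd (\<lambda>z. fd proj z (0, w)) z (0, v))" for v w
    by (rule smooth_on_derivative[OF 1])
  have l1: "linear (\<lambda>w. fd proj z (0, w))" if "z \<in> S" for z
    by (rule linear_fd_vertical[OF smooth_on_imp_differentiable[OF smooth_proj that]])
  have l2: "linear (\<lambda>w. fd (\<lambda>z. fd proj z (0, w)) z v)" if "z \<in> S" for v z
    by (rule fd_family_linear[OF open_S that l1 smooth_on_imp_differentiable[OF 1 that]])
  have l2': "linear (\<lambda>v. fd (\<lambda>z. fd proj z (0, w)) z (0, v))" if "z \<in> S" for w z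
    by (rule linear_fd_vertical[OF smooth_on_imp_differentiable[OF 1 that]])
  show ?thesis
    unfolding trilinear_def douglas_map_def
    by (intro conjI allI linear_fd_vertical[OF smooth_on_imp_differentiable[OF 2 assms]]
        fd_family_linear[OF open_S assms l2' smooth_on_imp_differentiable[OF 2 assms]]
        fd_family_linear[OF open_S assms l2 smooth_on_imp_differentiable[OF 2 assms]])
qed

lemma tens_douglas:
  assumes z: "z \<in> S"
  shows "tens (douglas f) z u v w = douglas_map z u v w"
proof (rule trilinear_eq_on_axes[OF trilinear_tens trilinear_douglas_map[OF z]])
  fix j k l
  note sm = smooth_on_dy[OF open_S]
  have 1: "fd proj z (0, axis l 1) = (\<chi> i. uncur (dy l (proj_coeff i)) z)" if "z \<in> S" for z
    by (rule vertical_derivative_vec[OF open_S smooth_proj_coeff proj_eq that])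
  have 2: "fd (\<lambda>z. fd proj z (0, axis l 1)) z (0, axis k 1) = (\<chi> i. uncur (dy k (dy l (proj_coeff i))) z)"
    if "z \<in> S" for z
    by (rule vertical_derivative_vec[OF open_S sm[OF smooth_proj_coeff] 1 that])
  have 3: "douglas_map z (axis j 1) (axis k 1) (axis l 1) = (\<chi> i. uncur (dy j (dy k (dy l (proj_coeff i)))) z)"
    unfolding douglas_map_def
    by (rule vertical_derivative_vec[OF open_S sm[OF sm[OF smooth_proj_coeff]] 2 z])
  show "tens (douglas f) z (axis j 1) (axis k 1) (axis l 1) = douglas_map z (axis j 1) (axis k 1) (axis l 1)"
    unfolding 3 by (simp add: vec_eq_iff tens_axis douglas_def)
qed

lemma smooth_Dtilde: "smooth_on S (uncur (Dtilde f j i k l))"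
  unfolding Dtilde_def by (rule smooth_hderiv0[OF smooth_douglas])

lemma tens_Dtilde: "z \<in> S \<Longrightarrow> tens (Dtilde f) z u v w = cov (tens (douglas f)) z u v w"
  unfolding Dtilde_def by (rule tens_hderiv0[OF smooth_douglas])

end

section \<open>Changes of coordinates\<close>

text \<open>Two coordinate expressions of one metric. \<open>W\<close> is the chart overlap seen in
  the source coordinates, so \<open>S\<close> and \<open>S'\<close> may be larger; the comparison
  takes place over \<open>W\<close> only.\<close>

locale coordinate_change =
  src: nondegenerate_metric S f + tgt: nondegenerate_metric S' f'
  for S S' :: "((real ^ 'n) \<times> (real ^ 'n)) set" and f f' :: "'n::finite local_fun" +
  fixes W :: "(real ^ 'n) set" and \<phi> :: "real ^ 'n \<Rightarrow> real ^ 'n"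
  assumes open_W: "open W" and smooth_\<phi>: "smooth_on W \<phi>"
    and inj_fd: "\<And>x. x \<in> W \<Longrightarrow> inj (fd \<phi> x)"
    and src_dom: "W \<times> - {0} \<subseteq> S"
    and tgt_dom: "\<And>x y. x \<in> W \<Longrightarrow> y \<noteq> 0 \<Longrightarrow> (\<phi> x, fd \<phi> x y) \<in> S'"
    and metric_eq: "\<And>x y. x \<in> W \<Longrightarrow> y \<noteq> 0 \<Longrightarrow> f x y = f' (\<phi> x) (fd \<phi> x y)"
begin

definition J :: "real ^ 'n \<Rightarrow> real ^ 'n \<Rightarrow> real ^ 'n" where
  "J x = fd \<phi> x"

definition H :: "real ^ 'n \<Rightarrow> real ^ 'n \<Rightarrow> real ^ 'n \<Rightarrow> real ^ 'n" where
  "H x u v = fd (\<lambda>x. J x v) x u"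

definition \<Phi> :: "(real ^ 'n) \<times> (real ^ 'n) \<Rightarrow> (real ^ 'n) \<times> (real ^ 'n)" where
  "\<Phi> z = (\<phi> (fst z), J (fst z) (snd z))"

definition D\<Phi> :: "(real ^ 'n) \<times> (real ^ 'n) \<Rightarrow> (real ^ 'n) \<times> (real ^ 'n) \<Rightarrow> (real ^ 'n) \<times> (real ^ 'n)" where
  "D\<Phi> z w = (J (fst z) (fst w), H (fst z) (fst w) (snd z) + J (fst z) (snd w))"

definition \<Omega> :: "((real ^ 'n) \<times> (real ^ 'n)) set" where
  "\<Omega> = W \<times> - {0}"

lemma open_\<Omega>: "open \<Omega>"
  unfolding \<Omega>_def by (intro open_Times open_W open_Compl closed_singleton)

lemma \<Omega>_src: "z \<in> \<Omega> \<Longrightarrow> z \<in> S"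
  using src_dom by (auto simp: \<Omega>_def)

lemma \<Omega>_tgt: "z \<in> \<Omega> \<Longrightarrow> \<Phi> z \<in> S'"
  using tgt_dom[of "fst z" "snd z"] by (simp add: \<Omega>_def \<Phi>_def J_def mem_Times_iff)

lemma \<Omega>_W: "z \<in> \<Omega> \<Longrightarrow> fst z \<in> W"
  by (auto simp: \<Omega>_def)

lemma smooth_J: "smooth_on W (\<lambda>x. J x v)"
  unfolding J_def by (rule smooth_on_derivative[OF smooth_\<phi>])

lemma linear_J: "x \<in> W \<Longrightarrow> linear (J x)"
  unfolding J_def by (rule smooth_on_linear_derivative[OF smooth_\<phi>])

lemma surj_J: "x \<in> W \<Longrightarrow> surj (J x)"
  using linear_injective_imp_surjective[OF linear_J] inj_fd by (simp add: J_def)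

text \<open>Schwarz's theorem for the transition map. It produces the cancellation in
  \<open>spray_transform\<close> and absorbs the factor 1/2 in
  \<open>nonlin_transform\<close>.\<close>

lemma H_sym: "x \<in> W \<Longrightarrow> H x u v = H x v u"
  unfolding H_def J_def using second_derivative_symmetric[OF smooth_\<phi> open_W] by metis

lemma linear_H1: "x \<in> W \<Longrightarrow> linear (\<lambda>u. H x u v)"
  unfolding H_def by (rule smooth_on_linear_derivative[OF smooth_J])

lemma linear_H2: "x \<in> W \<Longrightarrow> linear (H x u)"
  using linear_H1[of x u] H_sym by presburger

lemma J_has_derivative:
  assumes "x \<in> W"
  shows "((\<lambda>x. J x v) has_derivative (\<lambda>u. H x u v)) (at x)"
  unfolding H_def by (rule smooth_on_has_derivative[OF smooth_J assms])

lemma J_fst_has_derivative: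
  assumes "z \<in> \<Omega>"
  shows "((\<lambda>z. J (fst z) v) has_derivative (\<lambda>w. H (fst z) (fst w) v)) (at z)"
  by (rule has_derivative_compose[OF has_derivative_fst[OF has_derivative_ident] J_has_derivative[OF \<Omega>_W[OF assms]]])

lemma \<Phi>_has_derivative:
  assumes "z \<in> \<Omega>"
  shows "(\<Phi> has_derivative D\<Phi> z) (at z)"
proof -
  have "((\<lambda>z. \<phi> (fst z)) has_derivative (\<lambda>w. J (fst z) (fst w))) (at z)"
    unfolding J_def
    by (rule has_derivative_compose[OF has_derivative_fst[OF has_derivative_ident]
          smooth_on_has_derivative[OF smooth_\<phi> \<Omega>_W[OF assms]]])
  moreover have "((\<lambda>z. J (fst z) (snd z)) has_derivative
      (\<lambda>w. H (fst z) (fst w) (snd z) + J (fst z) (snd w))) (at z)"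
    by (rule linear_family_has_derivative[OF open_\<Omega> assms linear_J[OF \<Omega>_W] J_fst_has_derivative[OF assms]
          has_derivative_snd[OF has_derivative_ident]])
  ultimately have "((\<lambda>z. (\<phi> (fst z), J (fst z) (snd z))) has_derivative
      (\<lambda>w. (J (fst z) (fst w), H (fst z) (fst w) (snd z) + J (fst z) (snd w)))) (at z)"
    by (rule has_derivative_Pair)
  then show ?thesis
    unfolding \<Phi>_def[abs_def] D\<Phi>_def[abs_def] .
qed

lemma compose_\<Phi>_has_derivative:
  assumes "z \<in> \<Omega>" "smooth_on S' g"
  shows "((\<lambda>z. g (\<Phi> z)) has_derivative (\<lambda>w. fd g (\<Phi> z) (D\<Phi> z w))) (at z)"
  by (rule has_derivative_compose[OF \<Phi>_has_derivative[OF assms(1)] smooth_on_has_derivative[OF assms(2) \<Omega>_tgt[OF assms(1)]]])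

lemma D\<Phi>_vertical: "z \<in> \<Omega> \<Longrightarrow> D\<Phi> z (0, v) = (0, J (fst z) v)"
  using linear_0[OF linear_J] linear_0[OF linear_H1] by (simp add: D\<Phi>_def \<Omega>_W)

text \<open>For fixed \<open>x\<close> only the linear map \<open>J x\<close> enters, and no derivative of it.\<close>

lemma vertical_transform:
  assumes z: "(x, y) \<in> \<Omega>" and g: "smooth_on S g" and g': "smooth_on S' g'"
    and eq: "\<And>y. y \<noteq> 0 \<Longrightarrow> g' (\<Phi> (x, y)) = J x (g (x, y)) + q y"
    and q: "(q has_derivative q') (at y)"
  shows "fd g' (\<Phi> (x, y)) (0, J x v) = J x (fd g (x, y) (0, v)) + q' v"
proof -
  have x: "x \<in> W" and y: "y \<in> - {0}" using z by (auto simp: \<Omega>_def)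
  have "((\<lambda>y. g' (\<Phi> (x, y))) has_derivative (\<lambda>v. fd g' (\<Phi> (x, y)) (D\<Phi> (x, y) (0, v)))) (at y)"
    by (rule has_derivative_compose[where f = "\<lambda>y. (x, y)", OF _ compose_\<Phi>_has_derivative[OF z g']])
       (auto intro!: derivative_eq_intros)
  moreover have "((\<lambda>y. g' (\<Phi> (x, y))) has_derivative (\<lambda>v. J x (fd g (x, y) (0, v)) + q' v)) (at y)"
  proof (rule has_derivative_transform_within_open[OF _ open_Compl[OF closed_singleton[of 0]] y])
    show "((\<lambda>y. J x (g (x, y)) + q y) has_derivative (\<lambda>v. J x (fd g (x, y) (0, v)) + q' v)) (at y)"
      by (intro has_derivative_add q bounded_linear.has_derivative[OF linear_conv_bounded_linear[THEN iffD1, OF linear_J[OF x]]]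
          vertical_has_derivative smooth_on_imp_differentiable[OF g] \<Omega>_src z)
  qed (auto simp: eq)
  ultimately have "(\<lambda>v. fd g' (\<Phi> (x, y)) (D\<Phi> (x, y) (0, v))) = (\<lambda>v. J x (fd g (x, y) (0, v)) + q' v)"
    by (rule has_derivative_unique)
  from fun_cong[OF this, of v] show ?thesis
    by (simp add: D\<Phi>_vertical[OF z])
qed

section \<open>Transformation of the Euler-Lagrange equations and of the spray\<close>

lemma L_eq: "z \<in> \<Omega> \<Longrightarrow> src.L z = tgt.L (\<Phi> z)"
  using metric_eq[of "fst z" "snd z"] by (simp add: \<Omega>_def src.L_def tgt.L_def \<Phi>_def J_def mem_Times_iff)

lemma fd_L:
  assumes "z \<in> \<Omega>"
  shows "fd src.L z w = fd tgt.L (\<Phi> z) (D\<Phi> z w)"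
proof -
  have "(src.L has_derivative (\<lambda>w. fd tgt.L (\<Phi> z) (D\<Phi> z w))) (at z)"
    by (rule has_derivative_transform_within_open[OF compose_\<Phi>_has_derivative[OF assms tgt.smooth_L] open_\<Omega> assms])
       (simp add: L_eq)
  then show ?thesis by (simp flip: frechet_derivative_at)
qed

text \<open>The vertical direction \<open>J (fst z) v\<close> itself moves with the base point,
  which accounts for the additional \<open>H\<close> term.\<close>

lemma fd2_L:
  assumes z: "z \<in> \<Omega>"
  shows "fd (\<lambda>z. fd src.L z (0, v)) z w
    = fd (\<lambda>z'. fd tgt.L z' (0, J (fst z) v)) (\<Phi> z) (D\<Phi> z w) + fd tgt.L (\<Phi> z) (0, H (fst z) (fst w) v)"
proof -
  have "((\<lambda>z. fd tgt.L (\<Phi> z) (0, J (fst z) v)) has_derivative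
      (\<lambda>w. fd (\<lambda>z'. fd tgt.L z' (0, J (fst z) v)) (\<Phi> z) (D\<Phi> z w) + fd tgt.L (\<Phi> z) (0, H (fst z) (fst w) v))) (at z)"
    by (rule linear_family_has_derivative[where K = "\<lambda>z e. fd tgt.L (\<Phi> z) (0, e)", OF open_\<Omega> z _ _ J_fst_has_derivative[OF z]])
       (auto intro: linear_fd_vertical smooth_on_imp_differentiable[OF tgt.smooth_L] \<Omega>_tgt
         compose_\<Phi>_has_derivative[OF z] smooth_on_derivative[OF tgt.smooth_L])
  then have "((\<lambda>z. fd src.L z (0, v)) has_derivative
      (\<lambda>w. fd (\<lambda>z'. fd tgt.L z' (0, J (fst z) v)) (\<Phi> z) (D\<Phi> z w) + fd tgt.L (\<Phi> z) (0, H (fst z) (fst w) v))) (at z)"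
    by (rule has_derivative_transform_within_open[OF _ open_\<Omega> z]) (simp add: fd_L D\<Phi>_vertical)
  then show ?thesis by (simp flip: frechet_derivative_at)
qed

text \<open>The candidate is forced by the wish that \<Phi> carry the field \<open>(y, -2 G)\<close>
  to its counterpart. It solves the target Euler-Lagrange equations because the two sides acquire
  the terms \<open>H x y v\<close> and \<open>H x v y\<close>, which agree.\<close>

lemma spray_transform:
  assumes z: "z \<in> \<Omega>"
  shows "tgt.spray_vec (\<Phi> z) = J (fst z) (src.spray_vec z) - (1/2) *\<^sub>R H (fst z) (snd z) (snd z)"
proof (rule tgt.spray_unique[OF \<Omega>_tgt[OF z]])
  fix v'
  let ?x = "fst z" and ?y = "snd z" and ?G = "src.spray_vec z"
  let ?G' = "J ?x ?G - (1/2) *\<^sub>R H ?x ?y ?y"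
  note x = \<Omega>_W[OF z]
  \<comment> \<open>Surjectivity of the Jacobian makes every target test vector an image, so the
    source equations yield all target equations.\<close>
  obtain v where v: "v' = J ?x v" using surj_J[OF x] by (metis surjD)
  have D: "D\<Phi> z (?y, - 2 *\<^sub>R ?G) = (snd (\<Phi> z), - 2 *\<^sub>R ?G')"
    using linear_scale[OF linear_J[OF x], of "- 2" ?G] by (simp add: D\<Phi>_def \<Phi>_def scaleR_diff_right)
  have d: "tgt.L differentiable (at (\<Phi> z))"
    by (rule smooth_on_imp_differentiable[OF tgt.smooth_L \<Omega>_tgt[OF z]])
  have "fd (\<lambda>z. fd tgt.L z (0, v')) (\<Phi> z) (snd (\<Phi> z), - 2 *\<^sub>R ?G') + fd tgt.L (\<Phi> z) (0, H ?x ?y v)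
      = fd src.L z (v, 0)"
    using src.spray_Euler_Lagrange[OF \<Omega>_src[OF z], of v] fd2_L[OF z, of v "(?y, - 2 *\<^sub>R ?G)"]
    unfolding D v by simp
  also have "\<dots> = fd tgt.L (\<Phi> z) (v', 0) + fd tgt.L (\<Phi> z) (0, H ?x v ?y)"
    unfolding fd_L[OF z] using fd_split[OF d, of "J ?x v" "H ?x v ?y"] linear_0[OF linear_J[OF x]]
    by (simp add: D\<Phi>_def v)
  finally show "fd (\<lambda>z. fd tgt.L z (0, v')) (\<Phi> z) (snd (\<Phi> z), - 2 *\<^sub>R ?G') = fd tgt.L (\<Phi> z) (v', 0)"
    using H_sym[OF x, of ?y v] by simp
qed

section \<open>Transformation of the nonlinear and the Berwald connection\<close>

lemma H_has_derivative:
  assumes "x \<in> W"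
  shows "((\<lambda>y. H x y v) has_derivative (\<lambda>u. H x u v)) (at y)"
  by (rule bounded_linear_imp_has_derivative) (use linear_H1[OF assms] in \<open>simp add: linear_conv_bounded_linear\<close>)

lemma bilinear_H: "x \<in> W \<Longrightarrow> bilinear (H x)"
  by (simp add: bilinear_def linear_H1 linear_H2)

text \<open>Symmetry is not assumed, since the form \<open>b\<close> built in
  \<open>proj_transform\<close> need not be symmetric.\<close>

lemma bilinear_diag_has_derivative:
  fixes b :: "'a::euclidean_space \<Rightarrow> 'a \<Rightarrow> 'b::real_normed_vector"
  assumes "bilinear b"
  shows "((\<lambda>y. b y y) has_derivative (\<lambda>v. b y v + b v y)) (at y)"
  using bounded_bilinear.FDERIV[OF bilinear_conv_bounded_bilinear[THEN iffD1, OF assms] has_derivative_ident has_derivative_ident] .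

lemma nonlin_transform:
  assumes z: "z \<in> \<Omega>"
  shows "tgt.nonlin (\<Phi> z) (J (fst z) v) = J (fst z) (src.nonlin z v) - H (fst z) (snd z) v"
proof -
  obtain x y where xy: "z = (x, y)" by (cases z)
  have x: "x \<in> W" using \<Omega>_W[OF z] xy by simp
  have "fd tgt.spray_vec (\<Phi> (x, y)) (0, J x v)
      = J x (fd src.spray_vec (x, y) (0, v)) + (- (1/2)) *\<^sub>R (H x y v + H x v y)"
  proof (rule vertical_transform[OF _ src.smooth_spray_vec tgt.smooth_spray_vec])
    show "(x, y) \<in> \<Omega>" using z xy by simp
    show "tgt.spray_vec (\<Phi> (x, y)) = J x (src.spray_vec (x, y)) + (- (1/2)) *\<^sub>R H x y y" if "y \<noteq> 0" for y
      using spray_transform[of "(x, y)"] x that by (simp add: \<Omega>_def)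
    show "((\<lambda>y. (- (1/2)) *\<^sub>R H x y y) has_derivative (\<lambda>v. (- (1/2)) *\<^sub>R (H x y v + H x v y))) (at y)"
      by (rule has_derivative_scaleR_right[OF bilinear_diag_has_derivative[OF bilinear_H[OF x]]])
  qed
  moreover have "(- (1/2)) *\<^sub>R (H x y v + H x v y) = - H x y v"
    unfolding H_sym[OF x, of v y] by (simp flip: scaleR_2)
  ultimately show ?thesis
    by (simp add: tgt.nonlin_def src.nonlin_def xy)
qed

lemma berwald_transform:
  assumes z: "z \<in> \<Omega>"
  shows "tgt.berwald (\<Phi> z) (J (fst z) v) (J (fst z) w) = J (fst z) (src.berwald z v w) - H (fst z) v w"
proof -
  obtain x y where xy: "z = (x, y)" by (cases z)
  have x: "x \<in> W" using \<Omega>_W[OF z] xy by simp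
  have "fd (\<lambda>z. tgt.nonlin z (J x w)) (\<Phi> (x, y)) (0, J x v)
      = J x (fd (\<lambda>z. src.nonlin z w) (x, y) (0, v)) + - H x v w"
  proof (rule vertical_transform[OF _ src.smooth_nonlin tgt.smooth_nonlin])
    show "(x, y) \<in> \<Omega>" using z xy by simp
    show "tgt.nonlin (\<Phi> (x, y)) (J x w) = J x (src.nonlin (x, y) w) + - H x y w" if "y \<noteq> 0" for y
      using nonlin_transform[of "(x, y)"] x that by (simp add: \<Omega>_def)
    show "((\<lambda>y. - H x y w) has_derivative (\<lambda>v. - H x v w)) (at y)"
      by (rule has_derivative_minus[OF H_has_derivative[OF x]])
  qed
  then show ?thesis
    by (simp add: tgt.berwald_def src.berwald_def xy)
qed

text \<open>The new nonlinear connection is a conjugate of the old one minus \<open>H x y\<close>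
  composed with the inverse Jacobian. Conjugation preserves the trace and the second part has a
  trace linear in \<open>y\<close>, so the subtracted multiple of \<open>y\<close> changes by a
  quadratic form only.\<close>

lemma proj_transform:
  assumes x: "x \<in> W"
  obtains b where "bilinear b"
    "\<And>y. y \<noteq> 0 \<Longrightarrow> tgt.proj (\<Phi> (x, y)) = J x (src.proj (x, y)) + b y y"
proof -
  obtain K where K: "linear K" "\<And>v. K (J x v) = v" "\<And>v. J x (K v) = v"
  proof -
    obtain K where "linear K" "K \<circ> J x = id"
      using linear_injective_left_inverse[OF linear_J[OF x]] inj_fd[OF x] by (auto simp: J_def)
    moreover from this have "J x \<circ> K = id"
      using linear_inverse_left[OF linear_J[OF x]] by blast
    ultimately show ?thesis using that by (metis comp_apply id_apply)
  qed
  define c where "c = 1 / (real CARD('n) + 1)"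
  \<comment> \<open>By Jacobi's formula this is the derivative of \<open>log |det J|\<close> at
    \<open>x\<close> in direction \<open>y\<close>.\<close>
  define \<kappa> where "\<kappa> = (\<lambda>y. trace (matrix (\<lambda>v. H x y (K v))))"
  \<comment> \<open>Collects the correction of the spray and that of the trace term; only its values
    on the diagonal matter.\<close>
  define b where "b = (\<lambda>u v. - (1/2) *\<^sub>R H x u v + (c * \<kappa> u) *\<^sub>R J x v)"
  have \<kappa>: "linear \<kappa>"
    unfolding \<kappa>_def trace_def matrix_def
    by (rule linearI) (simp_all add: linear_add[OF linear_H1[OF x]] linear_scale[OF linear_H1[OF x]] sum.distrib sum_distrib_left)
  have "bilinear b"
    unfolding bilinear_def b_def
    by (auto intro!: linearI simp: linear_add[OF linear_H1[OF x]] linear_scale[OF linear_H1[OF x]]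
        linear_add[OF linear_H2[OF x]] linear_scale[OF linear_H2[OF x]] linear_add[OF linear_J[OF x]]
        linear_scale[OF linear_J[OF x]] linear_add[OF \<kappa>] linear_scale[OF \<kappa>] algebra_simps)
  moreover have "tgt.proj (\<Phi> (x, y)) = J x (src.proj (x, y)) + b y y" if "y \<noteq> 0" for y
  proof -
    have z: "(x, y) \<in> \<Omega>" using x that by (simp add: \<Omega>_def)
    let ?N = "src.nonlin (x, y)" and ?N' = "tgt.nonlin (\<Phi> (x, y))"
    have N: "linear ?N" by (rule src.linear_nonlin[OF \<Omega>_src[OF z]])
    have N': "?N' v = (J x \<circ> (?N \<circ> K)) v - H x y (K v)" for v
      using nonlin_transform[OF z, of "K v"] K(3) by simp
    have "trace (matrix ?N') = trace (matrix (J x \<circ> (?N \<circ> K))) - \<kappa> y"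
      by (simp add: trace_def matrix_def N' \<kappa>_def sum_subtractf)
    also have "matrix (J x \<circ> (?N \<circ> K)) = matrix (J x) ** (matrix ?N ** matrix K)"
      by (simp add: matrix_compose linear_compose K(1) N linear_J[OF x])
    also have "trace \<dots> = trace ((matrix ?N ** matrix K) ** matrix (J x))"
      by (rule trace_mul_sym)
    also have "\<dots> = trace (matrix (?N \<circ> (K \<circ> J x)))"
      by (simp add: matrix_compose linear_compose K(1) N linear_J[OF x] matrix_mul_assoc)
    also have "?N \<circ> (K \<circ> J x) = ?N" by (simp add: fun_eq_iff K(2))
    finally have tr: "trace (matrix ?N') = trace (matrix ?N) - \<kappa> y" .
    have "tgt.proj (\<Phi> (x, y)) = J x (src.spray_vec (x, y)) - (1/2) *\<^sub>R H x y y
        - (c * (trace (matrix ?N) - \<kappa> y)) *\<^sub>R J x y"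
      using spray_transform[OF z] unfolding tgt.proj_def tr c_def by (simp add: \<Phi>_def)
    also have "\<dots> = J x (src.proj (x, y)) + b y y"
      unfolding src.proj_def c_def[symmetric] b_def
      by (simp add: linear_diff[OF linear_J[OF x]] linear_scale[OF linear_J[OF x]] algebra_simps)
    finally show ?thesis .
  qed
  ultimately show ?thesis by (rule that)
qed

text \<open>Each identity holds at all nonzero \<open>y\<close> of the fibre and can be
  differentiated again. The error passes from \<open>b y y\<close> to \<open>b y w + b w y\<close>,
  then to \<open>b v w + b w v\<close>, which is constant in \<open>y\<close>, and finally to
  zero.\<close>

lemma douglas_transform:
  assumes z: "z \<in> \<Omega>"
  shows "tgt.douglas_map (\<Phi> z) (J (fst z) u) (J (fst z) v) (J (fst z) w) = J (fst z) (src.douglas_map z u v w)"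
proof -
  obtain x y where xy: "z = (x, y)" by (cases z)
  have x: "x \<in> W" using \<Omega>_W[OF z] xy by simp
  have y: "y \<noteq> 0" using z xy by (auto simp: \<Omega>_def)
  have \<Omega>: "(x, y) \<in> \<Omega>" if "y \<noteq> 0" for y using x that by (simp add: \<Omega>_def)
  obtain b where b: "bilinear b"
    and 0: "\<And>y. y \<noteq> 0 \<Longrightarrow> tgt.proj (\<Phi> (x, y)) = J x (src.proj (x, y)) + b y y"
    using proj_transform[OF x] by blast
  have lin: "linear (\<lambda>y. b y a + b a y)" for a
    using b linear_compose_add unfolding bilinear_def by blast
  note sm = smooth_on_derivative[OF src.smooth_proj] smooth_on_derivative[OF tgt.smooth_proj]
  have 1: "fd tgt.proj (\<Phi> (x, y)) (0, J x w) = J x (fd src.proj (x, y) (0, w)) + (b y w + b w y)"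
    if "y \<noteq> 0" for y
    by (rule vertical_transform[OF \<Omega>[OF that] src.smooth_proj tgt.smooth_proj 0 bilinear_diag_has_derivative[OF b]])
  have 2: "fd (\<lambda>z. fd tgt.proj z (0, J x w)) (\<Phi> (x, y)) (0, J x v)
      = J x (fd (\<lambda>z. fd src.proj z (0, w)) (x, y) (0, v)) + (b v w + b w v)" if "y \<noteq> 0" for y
    by (rule vertical_transform[OF \<Omega>[OF that] sm 1])
       (simp_all add: bounded_linear_imp_has_derivative lin linear_conv_bounded_linear[THEN iffD1])
  have "fd (\<lambda>z. fd (\<lambda>z. fd tgt.proj z (0, J x w)) z (0, J x v)) (\<Phi> (x, y)) (0, J x u)
      = J x (fd (\<lambda>z. fd (\<lambda>z. fd src.proj z (0, w)) z (0, v)) (x, y) (0, u)) + 0"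
    by (rule vertical_transform[OF \<Omega>[OF y] smooth_on_derivative[OF sm(1)] smooth_on_derivative[OF sm(2)] 2
          has_derivative_const])
  then show ?thesis
    by (simp add: xy src.douglas_map_def tgt.douglas_map_def)
qed

text \<open>The law \<open>eq\<close> is differentiated along the horizontal lift of
  \<open>y\<close>. Every occurrence of \<open>J\<close> contributes a term \<open>H x y\<close>,
  and the inhomogeneous part of the Berwald law removes it again: one term for the value, one for
  each argument.\<close>

lemma cov_transform:
  assumes z: "z \<in> \<Omega>"
    and t: "\<And>z. z \<in> S \<Longrightarrow> trilinear (t z)" "\<And>u v w. smooth_on S (\<lambda>z. t z u v w)"
    and t': "\<And>z. z \<in> S' \<Longrightarrow> trilinear (t' z)" "\<And>u v w. smooth_on S' (\<lambda>z. t' z u v w)"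
    and eq: "\<And>z u v w. z \<in> \<Omega> \<Longrightarrow> t' (\<Phi> z) (J (fst z) u) (J (fst z) v) (J (fst z) w) = J (fst z) (t z u v w)"
  shows "tgt.cov t' (\<Phi> z) (J (fst z) u) (J (fst z) v) (J (fst z) w) = J (fst z) (src.cov t z u v w)"
proof -
  let ?x = "fst z" and ?y = "snd z"
  let ?J = "J ?x"
  define V where "V = (?y, - src.nonlin z ?y)"
  note x = \<Omega>_W[OF z]
  \<comment> \<open>Horizontal lifts of \<open>y\<close> correspond under \<Phi>: the term
    \<open>H x y y\<close> in the derivative of \<Phi> is the one in the law of the nonlinear
    connection.\<close>
  have V: "D\<Phi> z V = (snd (\<Phi> z), - tgt.nonlin (\<Phi> z) (snd (\<Phi> z)))"
    using nonlin_transform[OF z, of ?y] linear_neg[OF linear_J[OF x]]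
    by (simp add: V_def D\<Phi>_def \<Phi>_def)
  have tri: "linear (\<lambda>a. t' (\<Phi> z) a c d)" "linear (\<lambda>a. t' (\<Phi> z) c a d)" "linear (t' (\<Phi> z) c d)"
    if "z \<in> \<Omega>" for z c d
    using t'(1)[OF \<Omega>_tgt[OF that]] by (auto simp: trilinear_def)
  define T where "T = (\<lambda>a c d w. fd (\<lambda>z. t' z a c d) (\<Phi> z) (D\<Phi> z w))"
  note JD = J_fst_has_derivative[OF z]
  have 0: "((\<lambda>z. t' (\<Phi> z) a c d) has_derivative T a c d) (at z)" for a c d
    unfolding T_def by (rule compose_\<Phi>_has_derivative[OF z t'(2)])
  \<comment> \<open>The arguments are set in motion one slot at a time, each adding one
    \<open>H\<close> term to the derivative.\<close>
  have 1: "((\<lambda>z. t' (\<Phi> z) (J (fst z) u) c d) has_derivative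
      (\<lambda>h. T (?J u) c d h + t' (\<Phi> z) (H ?x (fst h) u) c d)) (at z)" for c d
    by (rule linear_family_has_derivative[where K = "\<lambda>z a. t' (\<Phi> z) a c d", OF open_\<Omega> z tri(1) 0 JD])
  have 2: "((\<lambda>z. t' (\<Phi> z) (J (fst z) u) (J (fst z) v) d) has_derivative
      (\<lambda>h. (T (?J u) (?J v) d h + t' (\<Phi> z) (H ?x (fst h) u) (?J v) d)
        + t' (\<Phi> z) (?J u) (H ?x (fst h) v) d)) (at z)" for d
    by (rule linear_family_has_derivative[where K = "\<lambda>z a. t' (\<Phi> z) (J (fst z) u) a d", OF open_\<Omega> z tri(2) 1 JD])
  have 3: "((\<lambda>z. t' (\<Phi> z) (J (fst z) u) (J (fst z) v) (J (fst z) w)) has_derivative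
      (\<lambda>h. ((T (?J u) (?J v) (?J w) h + t' (\<Phi> z) (H ?x (fst h) u) (?J v) (?J w))
        + t' (\<Phi> z) (?J u) (H ?x (fst h) v) (?J w)) + t' (\<Phi> z) (?J u) (?J v) (H ?x (fst h) w))) (at z)"
    by (rule linear_family_has_derivative[where K = "\<lambda>z a. t' (\<Phi> z) (J (fst z) u) (J (fst z) v) a", OF open_\<Omega> z tri(3) 2 JD])
  have "((\<lambda>z. J (fst z) (t z u v w)) has_derivative
      (\<lambda>h. H ?x (fst h) (t z u v w) + ?J (fd (\<lambda>z. t z u v w) z h))) (at z)"
    by (rule linear_family_has_derivative[OF open_\<Omega> z linear_J[OF \<Omega>_W] JD smooth_on_has_derivative[OF t(2) \<Omega>_src[OF z]]])
  then have 4: "((\<lambda>z. t' (\<Phi> z) (J (fst z) u) (J (fst z) v) (J (fst z) w)) has_derivative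
      (\<lambda>h. H ?x (fst h) (t z u v w) + ?J (fd (\<lambda>z. t z u v w) z h))) (at z)"
    by (rule has_derivative_transform_within_open[OF _ open_\<Omega> z]) (simp add: eq)
  \<comment> \<open>\<open>3\<close> and \<open>4\<close> differentiate the same function of
    \<open>z\<close>. Evaluation at \<open>V\<close>, whose base component is \<open>y\<close>,
    turns every \<open>fst h\<close> into \<open>y\<close>.\<close>
  have *: "T (?J u) (?J v) (?J w) V = H ?x ?y (t z u v w) + ?J (fd (\<lambda>z. t z u v w) z V)
      - t' (\<Phi> z) (H ?x ?y u) (?J v) (?J w) - t' (\<Phi> z) (?J u) (H ?x ?y v) (?J w)
      - t' (\<Phi> z) (?J u) (?J v) (H ?x ?y w)"
    using fun_cong[OF has_derivative_unique[OF 3 4], of V] by (simp add: V_def algebra_simps)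
  have B: "tgt.berwald (\<Phi> z) (snd (\<Phi> z)) (?J a) = ?J (src.berwald z ?y a) - H ?x ?y a" for a
    using berwald_transform[OF z, of ?y a] by (simp add: \<Phi>_def)
  show ?thesis
    unfolding tgt.cov_def src.cov_def V[symmetric] V_def[symmetric] eq[OF z] B
      linear_diff[OF tri(1)[OF z]] linear_diff[OF tri(2)[OF z]] linear_diff[OF tri(3)[OF z]]
      linear_diff[OF linear_J[OF x]] linear_add[OF linear_J[OF x]]
    using * unfolding T_def by simp
qed

lemma Dtilde_transform:
  assumes z: "z \<in> \<Omega>"
  shows "tens (Dtilde f') (\<Phi> z) (J (fst z) u) (J (fst z) v) (J (fst z) w) = J (fst z) (tens (Dtilde f) z u v w)"
  unfolding src.tens_Dtilde[OF \<Omega>_src[OF z]] tgt.tens_Dtilde[OF \<Omega>_tgt[OF z]]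
  by (rule cov_transform[OF z])
     (simp_all add: trilinear_tens smooth_tens src.open_S tgt.open_S src.smooth_douglas tgt.smooth_douglas
       src.tens_douglas tgt.tens_douglas \<Omega>_src \<Omega>_tgt douglas_transform)

end

section \<open>Charts\<close>

lemma positive_definite_imp_invertible:
  fixes g :: "real ^ 'n ^ 'n"
  assumes "\<And>u. u \<noteq> 0 \<Longrightarrow> u \<bullet> (g *v u) > 0"
  shows "invertible g"
proof -
  have "\<forall>u. g *v u = 0 \<longrightarrow> u = 0" using assms by (metis inner_zero_right less_irrefl)
  then show ?thesis
    unfolding invertible_left_inverse matrix_left_invertible_ker .
qed

context
  fixes M :: "'a topology" and A :: "('a, 'n::finite) chart set"
  assumes M: "smooth_manifold M A"
begin

section \<open>Transition maps and the cocycle of their Jacobians\<close>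

lemma chart_homeomorphic:
  "c \<in> A \<Longrightarrow> homeomorphic_map (subtopology M (chart_dom c)) (top_of_set (chart_im c)) (snd c)"
  "c \<in> A \<Longrightarrow> openin M (chart_dom c)" "c \<in> A \<Longrightarrow> open (chart_im c)"
  using M by (auto simp: smooth_manifold_def)

lemma smooth_transition: "c \<in> A \<Longrightarrow> d \<in> A \<Longrightarrow> smooth_on (overlap c d) (transition c d)"
  using M by (auto simp: smooth_manifold_def)

lemma chart_inj: "c \<in> A \<Longrightarrow> inj_on (snd c) (chart_dom c)"
  using homeomorphic_imp_injective_map[OF chart_homeomorphic(1)] chart_homeomorphic(2)[THEN openin_subset]
  by (simp add: inf_absorb2)

lemma chart_inv_apply: "c \<in> A \<Longrightarrow> p \<in> chart_dom c \<Longrightarrow> chart_inv c (snd c p) = p"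
  unfolding chart_inv_def by (rule inv_into_f_f[OF chart_inj])

lemma open_overlap:
  assumes "c \<in> A" "d \<in> A"
  shows "open (overlap c d)"
proof -
  have "openin (subtopology M (chart_dom c)) (chart_dom c \<inter> chart_dom d)"
    using chart_homeomorphic(2) assms by (metis inf_commute openin_subtopology_Int)
  then have "openin (top_of_set (chart_im c)) (snd c ` (chart_dom c \<inter> chart_dom d))"
    using homeomorphic_imp_open_map[OF chart_homeomorphic(1)[OF assms(1)]] by (simp add: open_map_def)
  then show ?thesis
    unfolding overlap_def using chart_homeomorphic(3)[OF assms(1)] openin_open_trans by blast
qed

lemma overlapE:
  assumes "c \<in> A" "x \<in> overlap c d"
  obtains p where "p \<in> chart_dom c" "p \<in> chart_dom d" "x = snd c p" "chart_inv c x = p" "transition c d x = snd d p"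
  using assms chart_inv_apply[OF assms(1)] by (auto simp: overlap_def transition_def)

lemma slit_dom_open: "c \<in> A \<Longrightarrow> open (slit_dom c)"
  unfolding slit_dom_def by (intro open_Times chart_homeomorphic(3) open_Compl closed_singleton)

text \<open>The transition maps compose only on the triple overlap, but that set is open around
  \<open>x\<close>, which is enough for the chain rule.\<close>

lemma jac_compose:
  assumes "c \<in> A" "d \<in> A" "e \<in> A" "x \<in> overlap c d" "x \<in> overlap c e"
  shows "jac d e (transition c d x) (jac c d x y) = jac c e x y"
proof -
  let ?S = "overlap c d \<inter> overlap c e"
  have x': "transition c d x \<in> overlap d e"
  proof -
    obtain p where p: "p \<in> chart_dom d" "chart_inv c x = p" "transition c d x = snd d p"
      using overlapE[OF assms(1,4)] .
    moreover obtain q where "q \<in> chart_dom e" "chart_inv c x = q"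
      using overlapE[OF assms(1,5)] .
    ultimately show ?thesis by (auto simp: overlap_def)
  qed
  have d: "transition c d differentiable (at x)" "transition d e differentiable (at (transition c d x))"
    using smooth_on_imp_differentiable smooth_transition assms x' by blast+
  have "fd (transition d e \<circ> transition c d) x = fd (transition c e) x"
  proof (rule fd_cong)
    show "transition d e \<circ> transition c d differentiable (at x)"
      by (rule differentiable_chain_at[OF d])
    show "open ?S" using open_overlap assms by blast
    show "x \<in> ?S" using assms by blast
    show "(transition d e \<circ> transition c d) z = transition c e z" if "z \<in> ?S" for z
    proof -
      have "z \<in> overlap c d" using that by blast
      then obtain p where "p \<in> chart_dom d" "chart_inv c z = p"
        using overlapE[OF assms(1)] by metis
      then show ?thesis by (simp add: transition_def chart_inv_apply[OF assms(2)])
    qed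
  qed
  then show ?thesis
    unfolding jac_def frechet_derivative_compose[OF d] by (simp add: fun_eq_iff)
qed

lemma jac_refl:
  assumes "c \<in> A" "x \<in> chart_im c"
  shows "jac c c x = (\<lambda>y. y)"
proof -
  have "fd (\<lambda>x. x) x = fd (transition c c) x"
    by (rule fd_cong[where S = "chart_im c"])
       (use assms in \<open>auto simp: chart_homeomorphic transition_def chart_inv_apply\<close>)
  then show ?thesis by (simp add: jac_def)
qed

lemma jac_inverse:
  assumes "c \<in> A" "d \<in> A" "x \<in> overlap c d"
  shows "jac d c (transition c d x) (jac c d x y) = y"
proof -
  have x: "x \<in> overlap c c" "x \<in> chart_im c" using assms(3) by (auto simp: overlap_def)
  show ?thesis
    using jac_compose[OF assms(1,2,1,3) x(1)] jac_refl[OF assms(1) x(2)] by simp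
qed

text \<open>By the cocycle identity both coordinate pairs describe the same family of components.
  This is why a function on the tangent bundle has matching local expressions.\<close>

lemma tb_point_transition:
  assumes "c \<in> A" "d \<in> A" "x \<in> overlap c d"
  shows "tb_point A d (transition c d x) (jac c d x y) = tb_point A c x y"
proof -
  obtain p where p: "p \<in> chart_dom c" "p \<in> chart_dom d" "x = snd c p" "chart_inv c x = p" "transition c d x = snd d p"
    using overlapE[OF assms(1,3)] .
  have inv: "chart_inv d (transition c d x) = p" using p assms chart_inv_apply by simp
  have "jac d e (transition c d x) (jac c d x y) = jac c e x y" if "e \<in> A" "p \<in> chart_dom e" for e
  proof (rule jac_compose[OF assms(1,2) that(1) assms(3)])
    show "x \<in> overlap c e" using p that by (auto simp: overlap_def)
  qed
  then show ?thesis
    by (auto simp: tb_point_def inv p(4))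
qed

lemma finsler_nondegenerate:
  assumes "finsler_metric M A F" "c \<in> A"
  shows "nondegenerate_metric (slit_dom c) (local_expr A F c)"
proof
  show "open (slit_dom c)" by (rule slit_dom_open[OF assms(2)])
  show "smooth_on (slit_dom c) (uncur (local_expr A F c))"
    using assms by (simp add: finsler_metric_def smooth_on_slit_def case_prod_unfold)
  show "invertible (fund_tensor (local_expr A F c) (fst z) (snd z))" if "z \<in> slit_dom c" for z
    by (rule positive_definite_imp_invertible)
       (use assms that in \<open>auto simp: finsler_metric_def case_prod_unfold\<close>)
qed

lemma finsler_coordinate_change:
  assumes F: "finsler_metric M A F" and cd: "c \<in> A" "d \<in> A"
  shows "coordinate_change (slit_dom c) (slit_dom d) (local_expr A F c) (local_expr A F d)
    (overlap c d) (transition c d)"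
proof -
  interpret src: nondegenerate_metric "slit_dom c" "local_expr A F c"
    by (rule finsler_nondegenerate[OF F cd(1)])
  interpret tgt: nondegenerate_metric "slit_dom d" "local_expr A F d"
    by (rule finsler_nondegenerate[OF F cd(2)])
  show ?thesis
  proof
    show "open (overlap c d)" by (rule open_overlap[OF cd])
    show "smooth_on (overlap c d) (transition c d)" by (rule smooth_transition[OF cd])
    show "overlap c d \<times> - {0} \<subseteq> slit_dom c" by (auto simp: overlap_def slit_dom_def)
    fix x assume x: "x \<in> overlap c d"
    note inv = jac_inverse[OF cd x]
    show "inj (fd (transition c d) x)"
      by (rule inj_on_inverseI[where g = "jac d c (transition c d x)"]) (use inv in \<open>simp add: jac_def\<close>)
    fix y :: "real ^ 'n" assume y: "y \<noteq> 0"
    show "local_expr A F c x y = local_expr A F d (transition c d x) (fd (transition c d) x y)"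
      using tb_point_transition[OF cd x] by (simp add: local_expr_def jac_def)
    obtain p where p: "p \<in> chart_dom c" "p \<in> chart_dom d" "x = snd c p" "transition c d x = snd d p"
      using overlapE[OF cd(1) x] .
    have x': "transition c d x \<in> overlap d c" using p by (auto simp: overlap_def)
    have "linear (jac d c (transition c d x))"
      unfolding jac_def using smooth_on_linear_derivative[OF smooth_transition[OF cd(2,1)] x'] .
    \<comment> \<open>The reverse Jacobian is linear and recovers \<open>y\<close>, so the image of
      a nonzero vector stays off the zero section.\<close>
    from linear_0[OF this] have "jac c d x y \<noteq> 0" using inv[of y] y by auto
    then show "(transition c d x, fd (transition c d) x y) \<in> slit_dom d"
      using p by (auto simp: slit_dom_def jac_def)
  qed
qed

text \<open>Contracting the covector \<open>\<mu>\<close> with the upper index of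
  \<open>Dtilde\<close> consumes one Jacobian, leaving those of the three lower indices.\<close>

lemma tensor03_coeffs_contraction:
  assumes F: "finsler_metric M A F" and \<mu>: "tensor01_coeffs A \<mu>"
  shows "tensor03_coeffs A
    (\<lambda>c j k l x y. - (\<Sum>r\<in>UNIV. \<mu> c r x y * Dtilde (local_expr A F c) j r k l x y))"
  unfolding tensor03_coeffs_def
proof (intro conjI ballI allI impI)
  fix c j k l assume c: "c \<in> A"
  interpret nondegenerate_metric "slit_dom c" "local_expr A F c"
    by (rule finsler_nondegenerate[OF F c])
  have \<mu>': "smooth_on (slit_dom c) (uncur (\<mu> c r))" for r
    using \<mu> c by (simp add: tensor01_coeffs_def case_prod_unfold)
  show "smooth_on (slit_dom c)
      (\<lambda>(x, y). - (\<Sum>r\<in>UNIV. \<mu> c r x y * Dtilde (local_expr A F c) j r k l x y))"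
    unfolding case_prod_unfold
    by (intro smooth_on_minus smooth_on_sum smooth_on_mult open_S \<mu>' smooth_Dtilde)
next
  fix c d x and y :: "real ^ 'n" and j k l
  assume cd: "c \<in> A" "d \<in> A" and x: "x \<in> overlap c d" and y: "y \<noteq> 0"
  interpret coordinate_change "slit_dom c" "slit_dom d" "local_expr A F c" "local_expr A F d"
    "overlap c d" "transition c d"
    by (rule finsler_coordinate_change[OF F cd])
  have z: "(x, y) \<in> \<Omega>" using x y by (simp add: \<Omega>_def)
  let ?j = "jac_coeff c d" and ?x' = "transition c d x" and ?y' = "jac c d x y"
  let ?Dc = "Dtilde (local_expr A F c)" and ?Dd = "Dtilde (local_expr A F d)"
  have jac: "jac c d x = J x" by (simp add: jac_def J_def)
  define t where "t = tens ?Dc (x, y) (axis j 1) (axis k 1) (axis l 1)"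
  \<comment> \<open>Keeping the Jacobian on the source side of the upper index avoids its inverse:
    the law of \<open>\<mu>\<close> supplies precisely the sum over \<open>r\<close> that appears
    here.\<close>
  have Jt: "(\<Sum>r\<in>UNIV. ?j s r x * t $ r)
      = (\<Sum>p\<in>UNIV. \<Sum>q\<in>UNIV. \<Sum>r\<in>UNIV. ?Dd p s q r ?x' ?y' * ?j p j x * ?j q k x * ?j r l x)" for s
  proof -
    have "(\<Sum>r\<in>UNIV. ?j s r x * t $ r) = J x t $ s"
      using linear_sum_axis[OF linear_J[OF x], of t] by (simp add: jac_coeff_def jac mult.commute)
    also have "J x t = tens ?Dd (\<Phi> (x, y)) (J x (axis j 1)) (J x (axis k 1)) (J x (axis l 1))"
      using Dtilde_transform[OF z] by (simp add: t_def)
    finally show ?thesis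
      by (simp add: tens_def jac_coeff_def jac \<Phi>_def)
  qed
  have "(\<Sum>r\<in>UNIV. \<mu> c r x y * ?Dc j r k l x y) = (\<Sum>r\<in>UNIV. (\<Sum>s\<in>UNIV. ?j s r x * \<mu> d s ?x' ?y') * t $ r)"
    using \<mu> cd x y by (simp add: tensor01_coeffs_def t_def tens_axis)
  also have "\<dots> = (\<Sum>s\<in>UNIV. \<mu> d s ?x' ?y' * (\<Sum>r\<in>UNIV. ?j s r x * t $ r))"
    unfolding sum_distrib_left sum_distrib_right by (subst sum.swap) (simp add: mult_ac)
  also have "\<dots> = (\<Sum>s\<in>UNIV. \<Sum>p\<in>UNIV. \<Sum>q\<in>UNIV. \<Sum>r\<in>UNIV.
      ?j p j x * ?j q k x * ?j r l x * (\<mu> d s ?x' ?y' * ?Dd p s q r ?x' ?y'))"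
    unfolding Jt by (simp add: sum_distrib_left mult_ac)
  \<comment> \<open>The contracted index \<open>s\<close> moves inward past \<open>p\<close>,
    \<open>q\<close> and \<open>r\<close>, so that the innermost sum is the target
    contraction.\<close>
  also have "\<dots> = (\<Sum>p\<in>UNIV. \<Sum>q\<in>UNIV. \<Sum>r\<in>UNIV. \<Sum>s\<in>UNIV.
      ?j p j x * ?j q k x * ?j r l x * (\<mu> d s ?x' ?y' * ?Dd p s q r ?x' ?y'))"
    by (rule trans[OF sum.swap], rule sum.cong[OF refl], rule trans[OF sum.swap], rule sum.cong[OF refl],
        rule sum.swap)
  finally show "- (\<Sum>r\<in>UNIV. \<mu> c r x y * ?Dc j r k l x y)
      = (\<Sum>p\<in>UNIV. \<Sum>q\<in>UNIV. \<Sum>r\<in>UNIV. ?j p j x * ?j q k x * ?j r l x *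
          - (\<Sum>s\<in>UNIV. \<mu> d s ?x' ?y' * ?Dd p s q r ?x' ?y'))"
    by (simp add: sum_distrib_left sum_negf)
qed

end

theorem proposition4p6:
  fixes M :: "'a topology"
    and A :: "('a, 'n::finite) chart set"
    and F :: "'a \<times> ('a, 'n) tvec \<Rightarrow> real"
  assumes "smooth_manifold M A"
    and "finsler_metric M A F"
    and "generalized_Dtilde_metric A F"
  shows "W_GDW_metric A F"
proof -
  obtain \<mu> where \<mu>: "tensor01_coeffs A \<mu>" and eq: "\<And>c x y i j k l. c \<in> A \<Longrightarrow> (x, y) \<in> slit_dom c \<Longrightarrow>
      hderiv0 (local_expr A F c) (Dtilde (local_expr A F c)) j i k l x y
      + (\<Sum>r\<in>UNIV. \<mu> c r x y * Dtilde (local_expr A F c) j r k l x y) * y $ i = 0"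
    using assms(3) unfolding generalized_Dtilde_metric_def by blast
  let ?U = "\<lambda>c j k l x y. - (\<Sum>r\<in>UNIV. \<mu> c r x y * Dtilde (local_expr A F c) j r k l x y)"
  have "smooth_on_slit A (\<lambda>_. 0)"
    using slit_dom_open[OF assms(1)]
    by (simp add: smooth_on_slit_def local_expr_def case_prod_unfold smooth_on_const)
  moreover have "tensor03_coeffs A ?U"
    by (rule tensor03_coeffs_contraction[OF assms(1,2) \<mu>])
  moreover have "\<forall>c\<in>A. \<forall>(x, y)\<in>slit_dom c. \<forall>i j k l.
      hderiv0 (local_expr A F c) (Dtilde (local_expr A F c)) j i k l x y
      + local_expr A (\<lambda>_. 0) c x y * local_expr A F c x y * Dtilde (local_expr A F c) j i k l x y
      = ?U c j k l x y * y $ i"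
    using eq by (auto simp: local_expr_def[of _ "\<lambda>_. 0"] eq_neg_iff_add_eq_0)
  ultimately show ?thesis
    unfolding W_GDW_metric_def by blast
qed

end
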